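(* Let $T\subset\mathbb{R}^n$ be a closed subset and let $I\subset\mathbb{Z}_+^n$ be finite with $0\in I$. Fix $k\in\mathbb{Z}_+$ such that $\max_{i\in I}|i|<2k+2$. Let $(g_i)_{i\in I}$ be a family of real numbers with $g_0=1$, and fix an arbitrary constant $\epsilon>0$. Then the following statements (a), (b), (c) are equivalent. (a) There exists $f\in L^1_+(T,dt)$ such that $\int_T|t^i|f(t)\,dt<\infty$ and $$\int_T t^if(t)\,dt=g_i\qquad(i\in I).\qquad( * )$$ (b) There exists a particular solution $f_*$ of $( * )$ maximizing, amongst all solutions of $( * )$, the functional $$H(f)=-\int_T f\ln f\,dt-\epsilon\int_T\|t\|^{2k+2}f\,dt.$$ (c) The function $$L(\lambda)=\sum_{i\in I}g_i\lambda_i-\int_T e^{\sum_{i\in I}\lambda_it^i-\epsilon\|t\|^{2k+2}}\,dt+1\qquad(\lambda=(\lambda_i)_{i\in I}\in\mathbb{R}^{\operatorname{card} I})$$ satisfies $\sup L<\infty$. In this case: $\sup L$ is attained at a point $\lambda^*=(\lambda_i^* )_{i\in I}$, both $f_*$ and $\lambda^*$ are uniquely determined, $-H(f_* )=L(\lambda^* )$, and $$f_*(t)=e^{\sum_{i\in I}\lambda_i^*t^i-\epsilon\|t\|^{2k+2}};$$ in particular $$\int_T t^i\,e^{\sum_{j\in I}\lambda_j^*t^j}\,e^{-\epsilon\|t\|^{2k+2}}\,dt=g_i\qquad(i\in I).$$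
   Context: $\mathbb{Z}_+=\{0,1,2,\dots\}$; $dt$ is Lebesgue measure on $\mathbb{R}^n$; for $i=(i_1,\dots,i_n)\in\mathbb{Z}_+^n$, $t^i=t_1^{i_1}\cdots t_n^{i_n}$ and $|i|=i_1+\cdots+i_n$; $\|t\|=(\sum_{j=1}^n t_j^2)^{1/2}$. $L^1_+(T,dt)$ is the set of (classes of) Lebesgue integrable functions on $T$ that are $\ge0$ a.e. A solution of $( * )$ is an $f\in L^1_+(T,dt)$ with $\int_T|t^i|f\,dt<\infty$ for all $i\in I$ satisfying $( * )$. The convention $0\ln0=0$ is used. The functional $H$ is understood as the single integral $H(f)=-\int_T\big(\frac{f}{\rho}\ln\frac{f}{\rho}\big)\rho\,dt\in[-\infty,\infty)$ with $\rho(t)=e^{-\epsilon\|t\|^{2k+2}}$, which is always well defined for $f\in L^1_+(T,dt)$ and whose integrand equals $f\ln f+\epsilon\|t\|^{2k+2}f$. *)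

theory Defs
  imports "HOL-Analysis.Analysis"
begin

text \<open>
  Multi-indices are vectors of type \<open>nat ^ 'n\<close>, points are vectors of type \<open>real ^ 'n\<close>, so
  the dimension \<open>n \<ge> 1\<close> is \<open>CARD('n)\<close>.
\<close>

definition mpow :: "real ^ 'n \<Rightarrow> nat ^ 'n \<Rightarrow> real" where
  "mpow t i = (\<Prod>j\<in>UNIV. (t $ j) ^ (i $ j))"

definition mdeg :: "nat ^ 'n \<Rightarrow> nat" where
  "mdeg i = (\<Sum>j\<in>UNIV. i $ j)"

text \<open>
  Elements of \<open>L\<^sup>1\<^sub>+(T, dt)\<close> are represented by functions on the whole space, of which only the
  restriction to \<open>T\<close> matters; equality of classes is equality almost everywhere on \<open>T\<close>.
\<close>

definition L1_plus :: "(real ^ 'n) set \<Rightarrow> (real ^ 'n \<Rightarrow> real) set" where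
  "L1_plus T = {f. integrable (lebesgue_on T) f \<and> (AE t in lebesgue_on T. 0 \<le> f t)}"

definition moment_solution ::
    "(real ^ 'n) set \<Rightarrow> (nat ^ 'n) set \<Rightarrow> (nat ^ 'n \<Rightarrow> real) \<Rightarrow> (real ^ 'n \<Rightarrow> real) \<Rightarrow> bool" where
  "moment_solution T I g f \<longleftrightarrow> f \<in> L1_plus T \<and>
     (\<forall>i\<in>I. (\<integral>\<^sup>+t. ennreal (\<bar>mpow t i\<bar> * f t) \<partial>lebesgue_on T) < \<infinity> \<and>
            (\<integral>t. mpow t i * f t \<partial>lebesgue_on T) = g i)"

text \<open>
  The integral of a measurable function at least one of whose positive and negative parts has
  finite integral. For \<open>entropy_functional\<close> below the negative part always has finite integral,
  because \<open>x * ln x\<close> is bounded below and the weight is integrable.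
\<close>

definition extended_integral :: "'a measure \<Rightarrow> ('a \<Rightarrow> real) \<Rightarrow> ereal" where
  "extended_integral M u =
     enn2ereal (\<integral>\<^sup>+x. ennreal (u x) \<partial>M) - enn2ereal (\<integral>\<^sup>+x. ennreal (- u x) \<partial>M)"

definition weight :: "real \<Rightarrow> nat \<Rightarrow> real ^ 'n \<Rightarrow> real" where
  "weight \<epsilon> k t = exp (- \<epsilon> * norm t ^ (2 * k + 2))"

text \<open>
  Where \<open>f t \<ge> 0\<close>, the integrand equals \<open>f t * ln (f t) + \<epsilon> * norm t ^ (2 * k + 2) * f t\<close>.
  The convention \<open>0 * ln 0 = 0\<close> is automatic.
\<close>

definition entropy_functional ::
    "(real ^ 'n) set \<Rightarrow> real \<Rightarrow> nat \<Rightarrow> (real ^ 'n \<Rightarrow> real) \<Rightarrow> ereal" where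
  "entropy_functional T \<epsilon> k f =
     - extended_integral (lebesgue_on T)
         (\<lambda>t. (f t / weight \<epsilon> k t * ln (f t / weight \<epsilon> k t)) * weight \<epsilon> k t)"

definition entropy_maximizer ::
    "(real ^ 'n) set \<Rightarrow> (nat ^ 'n) set \<Rightarrow> (nat ^ 'n \<Rightarrow> real) \<Rightarrow> real \<Rightarrow> nat \<Rightarrow>
     (real ^ 'n \<Rightarrow> real) \<Rightarrow> bool" where
  "entropy_maximizer T I g \<epsilon> k f \<longleftrightarrow> moment_solution T I g f \<and>
     (\<forall>h. moment_solution T I g h \<longrightarrow> entropy_functional T \<epsilon> k h \<le> entropy_functional T \<epsilon> k f)"

text \<open>
  The parameter space \<open>\<real>\<close> to the power \<open>card I\<close> is \<open>I \<rightarrow>\<^sub>E UNIV\<close>: real families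
  indexed by \<open>I\<close>, with the irrelevant values outside \<open>I\<close> fixed so that uniqueness is meaningful.
\<close>

definition dual_functional ::
    "(real ^ 'n) set \<Rightarrow> (nat ^ 'n) set \<Rightarrow> (nat ^ 'n \<Rightarrow> real) \<Rightarrow> real \<Rightarrow> nat \<Rightarrow>
     (nat ^ 'n \<Rightarrow> real) \<Rightarrow> real" where
  "dual_functional T I g \<epsilon> k l =
     (\<Sum>i\<in>I. g i * l i)
     - (\<integral>t. exp ((\<Sum>i\<in>I. l i * mpow t i) - \<epsilon> * norm t ^ (2 * k + 2)) \<partial>lebesgue_on T) + 1"

definition sup_dual ::
    "(real ^ 'n) set \<Rightarrow> (nat ^ 'n) set \<Rightarrow> (nat ^ 'n \<Rightarrow> real) \<Rightarrow> real \<Rightarrow> nat \<Rightarrow> ereal" where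
  "sup_dual T I g \<epsilon> k = (SUP l\<in>(I \<rightarrow>\<^sub>E UNIV). ereal (dual_functional T I g \<epsilon> k l))"

end

theory Submission
  imports Defs
begin

text \<open>
  The maximum entropy problem is the convex dual of the maximization of the functional \<open>L\<close> in
  statement (c), and everything reduces to one condition on the data, called \<open>no_recession\<close>
  below: every nonzero polynomial \<open>\<Sum>i\<in>I. v i * t\<^sup>i\<close> that is \<open>\<le> 0\<close> almost everywhere on \<open>T\<close> satisfies
  \<open>(\<Sum>i\<in>I. g i * v i) < 0\<close>.

  The condition follows from the existence of a solution, since integrating the polynomial against
  a solution gives that sum (lemma \<open>solution_imp_no_recession\<close>). It also follows from \<open>sup L < \<infinity>\<close>,
  since otherwise \<open>L\<close> is unbounded on the span of \<open>v\<close> and the constant polynomial (lemma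
  \<open>dual_bounded_imp_no_recession\<close>). Conversely, the condition makes \<open>L\<close> coercive (lemma
  \<open>superlevel_set_bounded\<close>), so \<open>L\<close> attains its maximum at some \<open>\<lambda>\<close>, and the
  first-order condition there says that the Gibbs density
  \<open>exp (\<Sum>i\<in>I. \<lambda> i * t\<^sup>i - \<epsilon> * norm t ^ (2 * k + 2))\<close> has the prescribed moments (lemma
  \<open>dual_max_imp_solution\<close>).

  Once a Gibbs density solves the moment problem, the inequality
  \<open>x * p + x - exp p \<le> x * ln x\<close>, strict unless \<open>x = exp p\<close>, shows that it maximizes the entropy
  among all solutions, uniquely and with value \<open>- L \<lambda>\<close> (lemma \<open>free_energy_ge_dual\<close>); strict
  convexity of the exponential shows that \<open>\<lambda>\<close> is the only maximum of \<open>L\<close> (lemma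
  \<open>solution_gibbs_imp_dual_max\<close>).

  A nonzero polynomial vanishes only on a null set (lemma \<open>negligible_polynomial_zeros\<close>). Hence a
  polynomial as in the condition is even negative almost everywhere on \<open>T\<close>, which both derivations of
  the condition use, and Gibbs densities with different parameters differ on every set of positive
  measure. The bound on the degrees enters through the integrability of the Gibbs densities.
\<close>

section \<open>Extended integrals\<close>

lemma extended_integral_integrable:
  assumes "integrable M u"
  shows "extended_integral M u = ereal (\<integral>x. u x \<partial>M)"
proof -
  have fin: "(\<integral>\<^sup>+x. ennreal (u x) \<partial>M) \<noteq> \<infinity>" "(\<integral>\<^sup>+x. ennreal (- u x) \<partial>M) \<noteq> \<infinity>"
    using assms by (simp_all add: real_integrable_def)
  have "enn2ereal y = ereal (enn2real y)" if "y \<noteq> \<infinity>" for y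
    using that by (cases y) auto
  then show ?thesis
    using fin assms by (simp add: extended_integral_def real_lebesgue_integral_def)
qed

text \<open>
  The integrable minorant forces the negative part of \<open>u\<close> to have finite integral, so the
  extended integral is either \<open>\<infinity>\<close> or an ordinary integral.
\<close>

lemma extended_integral_ge:
  assumes u: "u \<in> borel_measurable M" and h: "integrable M h" and le: "AE x in M. h x \<le> u x"
  shows "ereal (\<integral>x. h x \<partial>M) \<le> extended_integral M u"
    and "extended_integral M u = ereal (\<integral>x. h x \<partial>M) \<Longrightarrow> AE x in M. u x = h x"
proof -
  have "(\<integral>\<^sup>+x. ennreal (- u x) \<partial>M) \<le> (\<integral>\<^sup>+x. ennreal (- h x) \<partial>M)"
    using le by (intro nn_integral_mono_AE) (auto elim!: eventually_mono intro: ennreal_leI)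
  also have "\<dots> < \<infinity>" using h by (simp add: real_integrable_def less_top)
  finally have neg: "(\<integral>\<^sup>+x. ennreal (- u x) \<partial>M) < \<infinity>" .
  have "extended_integral M u = \<infinity> \<or> integrable M u"
  proof (cases "(\<integral>\<^sup>+x. ennreal (u x) \<partial>M) = \<infinity>")
    case True
    have "enn2ereal (\<integral>\<^sup>+x. ennreal (- u x) \<partial>M) \<noteq> \<infinity>"
      using neg by auto
    then have "extended_integral M u = \<infinity>" unfolding extended_integral_def True by simp
    then show ?thesis ..
  next
    case False
    then show ?thesis using u neg by (simp add: real_integrable_def less_top)
  qed
  moreover have ge: "(\<integral>x. h x \<partial>M) \<le> (\<integral>x. u x \<partial>M)" if "integrable M u"
    using h that le by (rule integral_mono_AE)
  ultimately show "ereal (\<integral>x. h x \<partial>M) \<le> extended_integral M u"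
    by (auto simp: extended_integral_integrable)
  assume eq: "extended_integral M u = ereal (\<integral>x. h x \<partial>M)"
  then have int: "integrable M u"
    using \<open>extended_integral M u = \<infinity> \<or> integrable M u\<close> by auto
  then have "(\<integral>x. u x - h x \<partial>M) = 0"
    using eq h by (simp add: extended_integral_integrable)
  then have "AE x in M. u x - h x = 0"
    using int h le by (subst (asm) integral_nonneg_eq_0_iff_AE) auto
  then show "AE x in M. u x = h x" by simp
qed

section \<open>Convexity inequalities for the exponential\<close>

lemma exp_eq_add_one_iff: "exp x = 1 + x \<longleftrightarrow> x = (0::real)"
proof
  assume "exp x = 1 + x"
  then have "ln (exp x) = exp x - 1" by (metis ln_exp add_diff_cancel_left')
  then have "exp x = 1" by (intro ln_eq_minus_one) auto
  then show "x = 0" by simp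
qed simp

text \<open>
  The Fenchel-Young inequality for the conjugate pair \<open>x ln x - x\<close> and \<open>exp p\<close>. With
  \<open>z = p - ln x\<close> the gap is \<open>x * (exp z - 1 - z)\<close>, which vanishes only for \<open>z = 0\<close>.
\<close>

lemma x_ln_x_Young:
  fixes x p :: real
  assumes "x \<ge> 0"
  shows "x * p + x - exp p \<le> x * ln x"
    and "x * ln x = x * p + x - exp p \<Longrightarrow> x = exp p"
proof -
  have "x * p + x - exp p \<le> x * ln x \<and> (x * ln x = x * p + x - exp p \<longrightarrow> x = exp p)"
  proof (cases "x = 0")
    case False
    then have x: "x > 0" using assms by simp
    define z where "z = p - ln x"
    have xz: "exp p = x * exp z" using x by (simp add: z_def exp_diff)
    have p: "p = z + ln x" by (simp add: z_def)
    have diff: "x * ln x - (x * p + x - exp p) = x * (exp z - (1 + z))"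
      unfolding xz unfolding p by (simp add: algebra_simps)
    have "exp z = 1 + z" if "x * ln x = x * p + x - exp p"
      using diff that x by simp
    then have "x = exp p" if "x * ln x = x * p + x - exp p"
      using that xz by (simp add: exp_eq_add_one_iff)
    moreover have "x * (exp z - (1 + z)) \<ge> 0"
      using x exp_ge_add_one_self[of z] by simp
    ultimately show ?thesis using diff by linarith
  qed simp
  then show "x * p + x - exp p \<le> x * ln x"
    and "x * ln x = x * p + x - exp p \<Longrightarrow> x = exp p" by auto
qed

text \<open>
  A second-order remainder bound; it replaces differentiation under the integral sign in the
  first-order optimality condition for the dual functional.
\<close>

lemma exp_quadratic_bound: "exp z \<le> 1 + z + z\<^sup>2 * exp \<bar>z\<bar>" for z :: real
proof -
  have "exp z * (1 - z) \<le> exp z * exp (- z)"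
    using exp_ge_add_one_self[of "- z"] by (intro mult_left_mono) auto
  then have 1: "exp z - 1 \<le> z * exp z" by (simp add: algebra_simps flip: exp_add)
  have "z * (exp z - 1) \<le> z\<^sup>2 * exp \<bar>z\<bar>"
  proof (cases "z \<ge> 0")
    case True
    then show ?thesis using mult_left_mono[OF 1 True] by (simp add: power2_eq_square mult.assoc)
  next
    case False
    have "1 - exp z \<le> - z" using exp_ge_add_one_self[of z] by linarith
    also have "\<dots> \<le> - z * exp \<bar>z\<bar>" using False by simp
    finally have "- z * (1 - exp z) \<le> - z * (- z * exp \<bar>z\<bar>)"
      using False by (intro mult_left_mono) auto
    then show ?thesis by (simp add: power2_eq_square algebra_simps)
  qed
  with 1 show ?thesis by (simp add: algebra_simps)
qed

lemma square_le_exp: "y\<^sup>2 \<le> 2 * exp y" if "y \<ge> 0" for y :: real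
  using exp_lower_Taylor_quadratic[OF that] that by simp

section \<open>Moment problems and exponential families\<close>

text \<open>
  The duality argument uses only three properties of the monomials, the features \<open>\<phi> i\<close>: one of them is the constant
  \<open>1\<close> with prescribed moment \<open>1\<close>, exponentials of them are integrable against the weight, and
  no nontrivial linear combination vanishes on a set of positive measure. The last property
  holds vacuously on a null space, so \<open>M\<close> itself may be the zero measure.
\<close>

locale moment_family =
  fixes M :: "'a measure" and I :: "'i set" and \<phi> :: "'i \<Rightarrow> 'a \<Rightarrow> real"
    and w :: "'a \<Rightarrow> real" and g :: "'i \<Rightarrow> real" and i0 :: 'i
  assumes finite_I: "finite I" and i0: "i0 \<in> I"
    and \<phi>_i0: "\<And>x. \<phi> i0 x = 1" and g_i0: "g i0 = 1"
    and \<phi>_meas [measurable]: "\<And>i. \<phi> i \<in> borel_measurable M"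
    and w_meas [measurable]: "w \<in> borel_measurable M"
    and w_pos: "\<And>x. w x > 0"
    and exp_weight_integrable: "\<And>A. integrable M (\<lambda>x. exp (A * (\<Sum>i\<in>I. \<bar>\<phi> i x\<bar>)) * w x)"
    and independent: "\<And>v. \<exists>i\<in>I. v i \<noteq> 0 \<Longrightarrow> AE x in M. (\<Sum>i\<in>I. v i * \<phi> i x) \<noteq> 0"
begin

definition lin :: "('i \<Rightarrow> real) \<Rightarrow> 'a \<Rightarrow> real" where
  "lin v x = (\<Sum>i\<in>I. v i * \<phi> i x)"

definition pairing :: "('i \<Rightarrow> real) \<Rightarrow> real" where
  "pairing v = (\<Sum>i\<in>I. g i * v i)"

definition l1_norm :: "('i \<Rightarrow> real) \<Rightarrow> real" where
  "l1_norm v = (\<Sum>i\<in>I. \<bar>v i\<bar>)"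

definition envelope :: "'a \<Rightarrow> real" where
  "envelope x = (\<Sum>i\<in>I. \<bar>\<phi> i x\<bar>)"

definition gibbs :: "('i \<Rightarrow> real) \<Rightarrow> 'a \<Rightarrow> real" where
  "gibbs v x = exp (lin v x) * w x"

definition dual :: "('i \<Rightarrow> real) \<Rightarrow> real" where
  "dual v = pairing v - (\<integral>x. gibbs v x \<partial>M) + 1"

definition solution :: "('a \<Rightarrow> real) \<Rightarrow> bool" where
  "solution f \<longleftrightarrow> integrable M f \<and> (AE x in M. 0 \<le> f x) \<and>
     (\<forall>i\<in>I. integrable M (\<lambda>x. \<phi> i x * f x) \<and> (\<integral>x. \<phi> i x * f x \<partial>M) = g i)"

text \<open>
  The dual functional decreases to \<open>-\<infinity>\<close> along every ray. In a direction \<open>v\<close> with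
  \<open>lin v > 0\<close> on a set of positive measure this is due to the exponential integral; in the
  other directions that integral stays bounded along the ray, and the linear part
  has to be negative.
\<close>

definition no_recession :: bool where
  "no_recession \<longleftrightarrow> (\<forall>v. (\<exists>i\<in>I. v i \<noteq> 0) \<longrightarrow> (AE x in M. lin v x \<le> 0) \<longrightarrow> pairing v < 0)"

text \<open>
  The entropy relative to the density \<open>w\<close> with opposite sign, so that weak duality is a lower bound.
\<close>

definition free_energy :: "('a \<Rightarrow> real) \<Rightarrow> ereal" where
  "free_energy f = extended_integral M (\<lambda>x. (f x / w x * ln (f x / w x)) * w x)"

lemma lin_meas [measurable]: "lin v \<in> borel_measurable M"
  unfolding lin_def[abs_def] by measurable

lemma gibbs_pos: "gibbs v x > 0"
  by (simp add: gibbs_def w_pos)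

lemma envelope_nonneg: "envelope x \<ge> 0"
  by (simp add: envelope_def sum_nonneg)

lemma abs_le_l1_norm: "i \<in> I \<Longrightarrow> \<bar>v i\<bar> \<le> l1_norm v"
  unfolding l1_norm_def using finite_I by (intro member_le_sum) auto

lemma abs_\<phi>_le_envelope: "i \<in> I \<Longrightarrow> \<bar>\<phi> i x\<bar> \<le> envelope x"
  unfolding envelope_def using finite_I by (intro member_le_sum) auto

lemma abs_lin_le: "\<bar>lin v x\<bar> \<le> l1_norm v * envelope x"
proof -
  have "\<bar>lin v x\<bar> \<le> (\<Sum>i\<in>I. \<bar>v i\<bar> * \<bar>\<phi> i x\<bar>)"
    unfolding lin_def by (rule order.trans[OF sum_abs]) (simp add: abs_mult)
  also have "\<dots> \<le> (\<Sum>i\<in>I. l1_norm v * \<bar>\<phi> i x\<bar>)"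
    by (intro sum_mono mult_right_mono abs_le_l1_norm) auto
  finally show ?thesis by (simp add: envelope_def sum_distrib_left)
qed

lemma exp_lin_le: "exp (lin v x) \<le> exp (l1_norm v * envelope x)"
  using abs_lin_le[of v x] by simp

text \<open>
  All dominated convergence and integrability arguments compare with a multiple of
  \<open>exp (A * envelope) * w\<close>, which absorbs products of features and Gibbs densities.
\<close>

lemma integrable_weighted:
  assumes "F \<in> borel_measurable M" and "\<And>x. \<bar>F x\<bar> \<le> C * exp (A * envelope x)"
  shows "integrable M (\<lambda>x. F x * w x)"
proof (rule Bochner_Integration.integrable_bound)
  show "integrable M (\<lambda>x. C * (exp (A * envelope x) * w x))"
    unfolding envelope_def using exp_weight_integrable by simp
  show "AE x in M. norm (F x * w x) \<le> norm (C * (exp (A * envelope x) * w x))"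
  proof (rule AE_I2)
    fix x
    have "\<bar>F x\<bar> * w x \<le> C * exp (A * envelope x) * w x"
      using assms(2)[of x] w_pos[of x] by (intro mult_right_mono) auto
    also have "\<dots> \<le> \<bar>C * exp (A * envelope x) * w x\<bar>" by (rule abs_ge_self)
    finally show "norm (F x * w x) \<le> norm (C * (exp (A * envelope x) * w x))"
      using w_pos[of x] by (simp add: abs_mult mult.assoc)
  qed
qed (use assms(1) in measurable)

lemma integrable_times_gibbs:
  assumes [measurable]: "F \<in> borel_measurable M" and F: "\<And>x. \<bar>F x\<bar> \<le> C * exp (A * envelope x)"
  shows "integrable M (\<lambda>x. F x * gibbs v x)"
proof -
  have "integrable M (\<lambda>x. (F x * exp (lin v x)) * w x)"
  proof (rule integrable_weighted)
    fix x
    have "\<bar>F x\<bar> * exp (lin v x) \<le> C * exp (A * envelope x) * exp (l1_norm v * envelope x)"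
      using F[of x] exp_lin_le[of v x] by (intro mult_mono order.trans[OF abs_ge_zero F]) auto
    then show "\<bar>F x * exp (lin v x)\<bar> \<le> C * exp ((A + l1_norm v) * envelope x)"
      by (simp add: abs_mult algebra_simps exp_add)
  qed measurable
  then show ?thesis by (simp add: gibbs_def mult.assoc)
qed

lemma integrable_gibbs: "integrable M (gibbs v)"
  using integrable_times_gibbs[of "\<lambda>_. 1" 1 0 v] by simp

lemma integrable_\<phi>_gibbs: "i \<in> I \<Longrightarrow> integrable M (\<lambda>x. \<phi> i x * gibbs v x)"
proof (rule integrable_times_gibbs[where C=1 and A=1])
  fix x assume "i \<in> I"
  then have "\<bar>\<phi> i x\<bar> \<le> envelope x" by (rule abs_\<phi>_le_envelope)
  also have "\<dots> \<le> exp (envelope x)" using exp_ge_add_one_self[of "envelope x"] by linarith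
  finally show "\<bar>\<phi> i x\<bar> \<le> 1 * exp (1 * envelope x)" by simp
qed measurable

lemma
  assumes "solution f"
  shows solution_lin_integrable: "integrable M (\<lambda>x. lin v x * f x)"
    and solution_lin_integral: "(\<integral>x. lin v x * f x \<partial>M) = pairing v"
proof -
  have eq: "lin v x * f x = (\<Sum>i\<in>I. v i * (\<phi> i x * f x))" for x
    by (simp add: lin_def sum_distrib_right mult.assoc)
  show "integrable M (\<lambda>x. lin v x * f x)"
    unfolding eq using assms by (auto simp: solution_def)
  show "(\<integral>x. lin v x * f x \<partial>M) = pairing v"
    unfolding eq pairing_def using assms
    by (subst Bochner_Integration.integral_sum) (auto simp: solution_def mult.commute intro!: sum.cong)
qed

lemma solution_mass:
  assumes "solution f"
  shows "(\<integral>x. f x \<partial>M) = 1"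
  using assms i0 unfolding solution_def by (force simp: \<phi>_i0 g_i0)

lemma solution_not_AE_False: "solution f \<Longrightarrow> \<not> (AE x in M. False)"
proof
  assume "solution f" "AE x in M. False"
  then have "(\<integral>x. f x \<partial>M) = 0"
    by (intro integral_eq_zero_AE) auto
  with solution_mass[OF \<open>solution f\<close>] show False by simp
qed

lemma AE_lin_neg:
  assumes "\<exists>i\<in>I. v i \<noteq> 0" "AE x in M. lin v x \<le> 0"
  shows "AE x in M. lin v x < 0"
  using independent[OF assms(1)] assms(2) unfolding lin_def by eventually_elim simp

text \<open>
  A solution \<open>f\<close> represents \<open>pairing v\<close> as the integral of \<open>lin v * f\<close>. When \<open>lin v \<le> 0\<close>
  almost everywhere it is even strictly negative almost everywhere, so the integral can only
  vanish if \<open>f\<close> does, which contradicts total mass one. When \<open>f\<close> has entropy \<open>-\<infinity>\<close>, weak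
  duality gives no bound on the dual functional, but this argument still applies.
\<close>

lemma solution_imp_no_recession:
  assumes f: "solution f"
  shows no_recession
  unfolding no_recession_def
proof (intro allI impI)
  fix v assume v: "\<exists>i\<in>I. v i \<noteq> 0" "AE x in M. lin v x \<le> 0"
  have f0: "AE x in M. 0 \<le> f x" using f by (simp add: solution_def)
  show "pairing v < 0"
  proof (rule ccontr)
    assume "\<not> pairing v < 0"
    moreover have nonneg: "AE x in M. 0 \<le> - (lin v x * f x)"
      using v(2) f0 by eventually_elim (simp add: mult_nonpos_nonneg)
    moreover have int: "(\<integral>x. - (lin v x * f x) \<partial>M) = - pairing v"
      using solution_lin_integral[OF f] by simp
    ultimately have "(\<integral>x. - (lin v x * f x) \<partial>M) = 0"
      using integral_nonneg_AE[OF nonneg] by simp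
    then have "AE x in M. - (lin v x * f x) = 0"
      using solution_lin_integrable[OF f] nonneg by (subst (asm) integral_nonneg_eq_0_iff_AE) auto
    then have "AE x in M. f x = 0"
      using AE_lin_neg[OF v] by eventually_elim auto
    then have "(\<integral>x. f x \<partial>M) = 0" by (rule integral_eq_zero_AE)
    with solution_mass[OF f] show False by simp
  qed
qed

text \<open>
  Suppose \<open>lin v \<le> 0\<close> and \<open>pairing v \<ge> 0\<close>. Along \<open>n * v\<close> the exponential integral tends
  to zero, because \<open>lin v < 0\<close> almost everywhere. This leaves room to add an arbitrarily large
  multiple \<open>c\<close> of the constant feature: for large \<open>n\<close> the factor \<open>exp c\<close> is compensated while
  the linear part gains \<open>c\<close>. Hence the dual functional is unbounded.
\<close>

lemma dual_bounded_imp_no_recession: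
  assumes bdd: "\<And>l. dual l \<le> B"
  shows no_recession
  unfolding no_recession_def
proof (intro allI impI)
  fix v assume v: "\<exists>i\<in>I. v i \<noteq> 0" "AE x in M. lin v x \<le> 0"
  show "pairing v < 0"
  proof (rule ccontr)
    assume pos: "\<not> pairing v < 0"
    define c where "c = B + 1"
    have "(\<lambda>n. \<integral>x. exp (real n * lin v x) * w x \<partial>M) \<longlonglongrightarrow> (\<integral>x. 0 \<partial>M)"
    proof (rule integral_dominated_convergence)
      show "integrable M w" using exp_weight_integrable[of 0] by simp
      show "AE x in M. (\<lambda>n. exp (real n * lin v x) * w x) \<longlonglongrightarrow> 0"
        using AE_lin_neg[OF v]
      proof eventually_elim
        fix x assume "lin v x < 0"
        then have "(\<lambda>n. exp (lin v x) ^ n) \<longlonglongrightarrow> 0" by (intro LIMSEQ_realpow_zero) auto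
        then have "(\<lambda>n. exp (lin v x) ^ n * w x) \<longlonglongrightarrow> 0" by (rule tendsto_mult_left_zero)
        then show "(\<lambda>n. exp (real n * lin v x) * w x) \<longlonglongrightarrow> 0" by (simp add: exp_of_nat_mult)
      qed
      show "AE x in M. norm (exp (real n * lin v x) * w x) \<le> w x" for n
        using v(2) by eventually_elim (use w_pos in \<open>simp add: abs_mult mult_nonneg_nonpos less_imp_le\<close>)
    qed measurable
    then have "eventually (\<lambda>n. (\<integral>x. exp (real n * lin v x) * w x \<partial>M) < exp (- c)) sequentially"
      by (intro order_tendstoD) auto
    then obtain n where n: "(\<integral>x. exp (real n * lin v x) * w x \<partial>M) < exp (- c)"
      by (auto simp: eventually_sequentially)
    define l where "l i = real n * v i + (if i = i0 then c else 0)" for i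
    have split: "(\<Sum>i\<in>I. l i * y i) = real n * (\<Sum>i\<in>I. v i * y i) + c * y i0" for y
    proof -
      have "(\<Sum>i\<in>I. l i * y i) = (\<Sum>i\<in>I. real n * (v i * y i) + (if i = i0 then c * y i0 else 0))"
        by (intro sum.cong) (auto simp: l_def algebra_simps)
      then show ?thesis
        using finite_I i0 by (simp add: sum.distrib sum_distrib_left)
    qed
    have "pairing l = real n * pairing v + c"
      using split[of g] by (simp add: pairing_def g_i0 mult.commute)
    then have "pairing l \<ge> c" using pos by simp
    moreover have "(\<integral>x. gibbs l x \<partial>M) = exp c * (\<integral>x. exp (real n * lin v x) * w x \<partial>M)"
      using split[of "\<lambda>i. \<phi> i _"] by (simp add: gibbs_def lin_def \<phi>_i0 exp_add mult_ac)
    moreover have "exp c * (\<integral>x. exp (real n * lin v x) * w x \<partial>M) \<le> exp c * exp (- c)"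
      using n by (intro mult_left_mono) auto
    ultimately have "dual l \<ge> c" by (simp add: dual_def flip: exp_add)
    with bdd[of l] show False by (simp add: c_def)
  qed
qed

section \<open>Coercivity and attainment of the dual supremum\<close>

lemma tendsto_integral_lin:
  assumes F: "continuous_on UNIV F" "\<And>y. \<bar>F y\<bar> \<le> C * exp \<bar>y\<bar>"
    and u: "\<And>i. i \<in> I \<Longrightarrow> (\<lambda>n. u n i) \<longlonglongrightarrow> v i" and bdd: "\<And>n. l1_norm (u n) \<le> N"
  shows "(\<lambda>n. \<integral>x. F (lin (u n) x) * w x \<partial>M) \<longlonglongrightarrow> (\<integral>x. F (lin v x) * w x \<partial>M)"
proof (rule integral_dominated_convergence)
  have [measurable]: "F \<in> borel_measurable borel"
    using F(1) by (rule borel_measurable_continuous_onI)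
  show "(\<lambda>x. F (lin v x) * w x) \<in> borel_measurable M"
    and "\<And>n. (\<lambda>x. F (lin (u n) x) * w x) \<in> borel_measurable M" by measurable
  show "integrable M (\<lambda>x. C * (exp (N * envelope x) * w x))"
    unfolding envelope_def using exp_weight_integrable by simp
  show "AE x in M. (\<lambda>n. F (lin (u n) x) * w x) \<longlonglongrightarrow> F (lin v x) * w x"
  proof (rule AE_I2)
    fix x
    have "(\<lambda>n. lin (u n) x) \<longlonglongrightarrow> lin v x"
      unfolding lin_def using u by (intro tendsto_intros)
    then show "(\<lambda>n. F (lin (u n) x) * w x) \<longlonglongrightarrow> F (lin v x) * w x"
      using F(1) by (intro tendsto_mult_right continuous_on_tendsto_compose[OF F(1)]) auto
  qed
  have C: "C \<ge> 0" using F(2)[of 0] by (smt (verit) exp_zero abs_zero mult_cancel_left1 abs_ge_zero)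
  show "AE x in M. norm (F (lin (u n) x) * w x) \<le> C * (exp (N * envelope x) * w x)" for n
  proof (rule AE_I2)
    fix x
    have "\<bar>lin (u n) x\<bar> \<le> N * envelope x"
      using abs_lin_le[of "u n" x] mult_right_mono[OF bdd envelope_nonneg, of n x] by simp
    then have "C * exp \<bar>lin (u n) x\<bar> \<le> C * exp (N * envelope x)"
      using C by (intro mult_left_mono) auto
    with F(2)[of "lin (u n) x"] have "\<bar>F (lin (u n) x)\<bar> * w x \<le> C * exp (N * envelope x) * w x"
      using w_pos[of x] by (intro mult_right_mono) auto
    then show "norm (F (lin (u n) x) * w x) \<le> C * (exp (N * envelope x) * w x)"
      using w_pos[of x] by (simp add: abs_mult mult.assoc)
  qed
qed

lemma bounded_parameters_subsequence:
  assumes "\<And>n. l1_norm (u n) \<le> N"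
  obtains r v where "strict_mono (r :: nat \<Rightarrow> nat)" "\<And>i. i \<in> I \<Longrightarrow> (\<lambda>n. u (r n) i) \<longlonglongrightarrow> v i"
proof -
  have bdd: "bounded ((\<lambda>x. x i) ` range u)" if "i \<in> I" for i
    unfolding bounded_iff using abs_le_l1_norm[OF that] assms
    by (intro exI[of _ N]) (auto intro: order.trans)
  obtain v r where r: "strict_mono (r :: nat \<Rightarrow> nat)"
    and conv: "\<forall>e>0. eventually (\<lambda>n. \<forall>i\<in>I. dist (u (r n) i) (v i) < e) sequentially"
    using compact_lemma_general[of I "\<lambda>x i. x i" u "\<lambda>x. x"] finite_I bdd by auto
  have "(\<lambda>n. u (r n) i) \<longlonglongrightarrow> v i" if "i \<in> I" for i
  proof (rule tendstoI)
    fix e :: real assume "e > 0"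
    with conv have "eventually (\<lambda>n. \<forall>i\<in>I. dist (u (r n) i) (v i) < e) sequentially" by blast
    then show "eventually (\<lambda>n. dist (u (r n) i) (v i) < e) sequentially"
      by eventually_elim (use that in blast)
  qed
  with r show ?thesis by (rule that)
qed

lemma pairing_le: "\<bar>pairing v\<bar> \<le> (\<Sum>i\<in>I. \<bar>g i\<bar>) * l1_norm v"
proof -
  have "\<bar>pairing v\<bar> \<le> (\<Sum>i\<in>I. \<bar>g i\<bar> * \<bar>v i\<bar>)"
    unfolding pairing_def by (rule order.trans[OF sum_abs]) (simp add: abs_mult)
  also have "\<dots> \<le> (\<Sum>i\<in>I. \<bar>g i\<bar> * l1_norm v)"
    by (intro sum_mono mult_left_mono abs_le_l1_norm) auto
  finally show ?thesis by (simp add: sum_distrib_right)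
qed

lemma gibbs_integral_nonneg: "(\<integral>x. gibbs v x \<partial>M) \<ge> 0"
  using gibbs_pos by (intro integral_nonneg_AE) (auto intro: less_imp_le)

text \<open>
  Coercivity of the dual functional. Were a superlevel set unbounded, take points \<open>l n\<close> in it
  of norm \<open>N n \<rightarrow> \<infinity>\<close>; the normalized directions \<open>u n\<close> have a limit point \<open>v \<noteq> 0\<close>. The lower
  bound on the dual functional yields \<open>pairing v \<ge> 0\<close>, and it bounds the integral of
  \<open>exp (N n * lin (u n)) * w\<close> by a multiple of \<open>N n\<close>. Since the exponential dominates a
  square, the integral of \<open>(max 0 (lin (u n)))\<^sup>2 * w\<close> is of order \<open>1 / N n\<close>, and in the limit
  \<open>lin v \<le> 0\<close> almost everywhere. Such a \<open>v\<close> is excluded by \<open>no_recession\<close>.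
\<close>

lemma superlevel_set_bounded:
  assumes no_recession
  obtains R where "\<And>l. c \<le> dual l \<Longrightarrow> l1_norm l \<le> R"
proof (rule ccontr)
  assume "\<not> thesis"
  then have "\<forall>n::nat. \<exists>l. c \<le> dual l \<and> real (Suc n) < l1_norm l"
    using that by (meson not_less)
  then obtain l where l: "\<And>n. c \<le> dual (l n)" "\<And>n. real (Suc n) < l1_norm (l n)"
    by metis
  define N where "N n = l1_norm (l n)" for n
  have N1: "N n > 1" and Nn: "real n \<le> N n" for n using l(2)[of n] by (auto simp: N_def)
  define u where "u n i = l n i / N n" for n i
  have lu: "l n i = N n * u n i" for n i using N1[of n] by (simp add: u_def)
  have size_u: "l1_norm (u n) = 1" for n
    using N1[of n] by (simp add: u_def l1_norm_def flip: sum_divide_distrib) (simp add: N_def l1_norm_def)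
  obtain r v where r: "strict_mono (r :: nat \<Rightarrow> nat)"
    and conv: "\<And>i. i \<in> I \<Longrightarrow> (\<lambda>n. u (r n) i) \<longlonglongrightarrow> v i"
    using bounded_parameters_subsequence[of u 1] size_u by auto
  have "filterlim (\<lambda>n. N (r n)) at_top sequentially"
  proof (rule filterlim_at_top_mono[OF filterlim_real_sequentially])
    show "\<forall>\<^sub>F n in sequentially. real n \<le> N (r n)"
      using Nn seq_suble[OF r] by (intro always_eventually) (meson of_nat_mono order.trans)
  qed
  then have lim0: "(\<lambda>n. K / N (r n)) \<longlonglongrightarrow> 0" for K
    by (rule real_tendsto_divide_at_top[OF tendsto_const])
  have pair: "pairing (l n) = N n * pairing (u n)" for n
    unfolding pairing_def by (simp add: lu sum_distrib_left mult_ac)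
  have linl: "lin (l n) x = N n * lin (u n) x" for n x
    unfolding lin_def by (simp add: lu sum_distrib_left mult_ac)
  have upper: "(\<integral>x. gibbs (l n) x \<partial>M) \<le> N n * pairing (u n) + 1 - c" for n
    using l(1)[of n] by (simp add: dual_def pair)
  have "(c - 1) / N n \<le> pairing (u n)" for n
    using upper[of n] gibbs_integral_nonneg[of "l n"] N1[of n] by (simp add: field_simps)
  moreover have "(\<lambda>n. pairing (u (r n))) \<longlonglongrightarrow> pairing v"
    unfolding pairing_def using conv by (intro tendsto_intros)
  ultimately have "0 \<le> pairing v"
    using LIMSEQ_le[OF lim0[of "c - 1"], of "\<lambda>n. pairing (u (r n))" "pairing v"] by auto
  moreover have "AE x in M. lin v x \<le> 0"
  proof -
    define F where "F y = (max 0 y)\<^sup>2" for y :: real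
    have F_le: "F y \<le> 2 * exp y" for y
      using square_le_exp[of "max 0 y"] by (auto simp: F_def max_def)
    have F_abs: "\<bar>F y\<bar> \<le> 2 * exp \<bar>y\<bar>" for y
      by (rule order.trans[of _ "2 * exp y"]) (use F_le[of y] in \<open>auto simp: F_def\<close>)
    have F_cont: "continuous_on UNIV F" unfolding F_def by (intro continuous_intros)
    have [measurable]: "F \<in> borel_measurable borel"
      using F_cont by (rule borel_measurable_continuous_onI)
    have F_int: "integrable M (\<lambda>x. F (lin v x) * w x)" for v
    proof (rule integrable_weighted)
      fix x show "\<bar>F (lin v x)\<bar> \<le> 2 * exp (l1_norm v * envelope x)"
        using F_abs[of "lin v x"] abs_lin_le[of v x] by (meson exp_le_cancel_iff mult_left_mono order.trans zero_le_numeral)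
    qed measurable
    define K where "K = 2 * ((\<Sum>i\<in>I. \<bar>g i\<bar>) + \<bar>1 - c\<bar>)"
    have small: "(\<integral>x. F (lin (u n) x) * w x \<partial>M) \<le> K / N n" for n
    proof -
      have "(N n)\<^sup>2 * (\<integral>x. F (lin (u n) x) * w x \<partial>M) = (\<integral>x. (N n)\<^sup>2 * (F (lin (u n) x) * w x) \<partial>M)"
        by simp
      also have "\<dots> \<le> (\<integral>x. 2 * gibbs (l n) x \<partial>M)"
      proof (rule integral_mono)
        show "integrable M (\<lambda>x. (N n)\<^sup>2 * (F (lin (u n) x) * w x))" using F_int by simp
        show "integrable M (\<lambda>x. 2 * gibbs (l n) x)" using integrable_gibbs by simp
        fix x
        have "(N n)\<^sup>2 * F (lin (u n) x) = F (lin (l n) x)"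
          unfolding F_def linl using N1[of n]
          by (auto simp: max_def power_mult_distrib mult_le_0_iff zero_le_mult_iff)
        then show "(N n)\<^sup>2 * (F (lin (u n) x) * w x) \<le> 2 * gibbs (l n) x"
          using mult_right_mono[OF F_le[of "lin (l n) x"], of "w x"] w_pos[of x]
          by (simp add: gibbs_def mult.assoc[symmetric])
      qed
      also have "\<dots> \<le> 2 * (N n * pairing (u n) + 1 - c)" using upper[of n] by simp
      also have "\<dots> \<le> K * N n"
      proof -
        have "pairing (u n) \<le> (\<Sum>i\<in>I. \<bar>g i\<bar>)" using pairing_le[of "u n"] by (simp add: size_u)
        then have "N n * pairing (u n) \<le> N n * (\<Sum>i\<in>I. \<bar>g i\<bar>)"
          using N1[of n] by (intro mult_left_mono) auto
        moreover have "1 - c \<le> N n * \<bar>1 - c\<bar>"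
          using mult_right_mono[of 1 "N n" "\<bar>1 - c\<bar>"] N1[of n] by (auto intro: order.trans[OF abs_ge_self])
        ultimately show ?thesis unfolding K_def by (simp add: algebra_simps)
      qed
      finally have "N n * ((\<integral>x. F (lin (u n) x) * w x \<partial>M) * N n) \<le> N n * K"
        by (simp only: power2_eq_square mult_ac)
      then have "(\<integral>x. F (lin (u n) x) * w x \<partial>M) * N n \<le> K"
        using N1[of n] by (simp only: mult_le_cancel_left_pos)
      then show ?thesis using N1[of n] by (simp only: pos_le_divide_eq)
    qed
    have "(\<lambda>n. \<integral>x. F (lin (u (r n)) x) * w x \<partial>M) \<longlonglongrightarrow> (\<integral>x. F (lin v x) * w x \<partial>M)"
      by (rule tendsto_integral_lin[OF F_cont F_abs conv, where N = 1]) (simp_all add: size_u)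
    then have "(\<integral>x. F (lin v x) * w x \<partial>M) \<le> 0"
      by (rule LIMSEQ_le[OF _ lim0[of K]]) (use small in blast)
    moreover have nonneg: "F (lin v x) * w x \<ge> 0" for x using w_pos[of x] by (simp add: F_def)
    ultimately have "(\<integral>x. F (lin v x) * w x \<partial>M) = 0"
      using Bochner_Integration.integral_nonneg[of M "\<lambda>x. F (lin v x) * w x"] by (intro antisym) auto
    then have "AE x in M. F (lin v x) * w x = 0"
      using F_int nonneg by (subst (asm) integral_nonneg_eq_0_iff_AE) auto
    then show ?thesis
    proof eventually_elim
      fix x assume "F (lin v x) * w x = 0"
      then show "lin v x \<le> 0" using w_pos[of x] by (auto simp: F_def max_def split: if_splits)
    qed
  qed
  moreover have "\<exists>i\<in>I. v i \<noteq> 0"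
  proof (rule ccontr)
    assume "\<not> (\<exists>i\<in>I. v i \<noteq> 0)"
    moreover have "(\<lambda>n. l1_norm (u (r n))) \<longlonglongrightarrow> l1_norm v"
      unfolding l1_norm_def using conv by (intro tendsto_intros)
    ultimately show False by (simp add: size_u) (simp add: l1_norm_def LIMSEQ_const_iff)
  qed
  ultimately show False using assms unfolding no_recession_def by fastforce
qed

lemma dual_attains_max:
  assumes no_recession
  obtains l where "\<And>l'. dual l' \<le> dual l"
proof -
  obtain R where R: "\<And>l. dual (\<lambda>_. 0) \<le> dual l \<Longrightarrow> l1_norm l \<le> R"
    using superlevel_set_bounded[OF assms] by blast
  define S where "S = {dual l |l. dual (\<lambda>_. 0) \<le> dual l}"
  have ne: "S \<noteq> {}" by (auto simp: S_def)
  have bdd: "bdd_above S"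
  proof (rule bdd_aboveI)
    fix y assume "y \<in> S"
    then obtain l where l: "y = dual l" "dual (\<lambda>_. 0) \<le> dual l" by (auto simp: S_def)
    have "pairing l \<le> (\<Sum>i\<in>I. \<bar>g i\<bar>) * l1_norm l" using pairing_le[of l] by linarith
    also have "\<dots> \<le> (\<Sum>i\<in>I. \<bar>g i\<bar>) * R" using R[OF l(2)] by (intro mult_left_mono) (auto simp: sum_nonneg)
    finally show "y \<le> (\<Sum>i\<in>I. \<bar>g i\<bar>) * R + 1"
      using gibbs_integral_nonneg[of l] by (simp add: l dual_def)
  qed
  have "\<exists>l. dual (\<lambda>_. 0) \<le> dual l \<and> Sup S - 1 / real (Suc n) < dual l" for n
  proof -
    have "Sup S - 1 / real (Suc n) < Sup S" by simp
    from less_cSupD[OF ne this] show ?thesis by (auto simp: S_def)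
  qed
  then obtain u where u: "\<And>n. dual (\<lambda>_. 0) \<le> dual (u n)" "\<And>n. Sup S - 1 / real (Suc n) < dual (u n)"
    by metis
  obtain r l where r: "strict_mono (r :: nat \<Rightarrow> nat)"
    and conv: "\<And>i. i \<in> I \<Longrightarrow> (\<lambda>n. u (r n) i) \<longlonglongrightarrow> l i"
    using bounded_parameters_subsequence[of u R] R[OF u(1)] by auto
  have "(\<lambda>n. \<integral>x. gibbs (u (r n)) x \<partial>M) \<longlonglongrightarrow> (\<integral>x. gibbs l x \<partial>M)"
    unfolding gibbs_def
    by (rule tendsto_integral_lin[where F = exp and C = 1 and N = R])
      (use conv R[OF u(1)] in \<open>auto intro: continuous_intros\<close>)
  then have "(\<lambda>n. dual (u (r n))) \<longlonglongrightarrow> dual l"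
    unfolding dual_def pairing_def using conv by (intro tendsto_intros)
  moreover have "(\<lambda>n. Sup S - 1 / real (Suc (r n))) \<longlonglongrightarrow> Sup S - 0"
    using LIMSEQ_subseq_LIMSEQ[OF LIMSEQ_inverse_real_of_nat r]
    by (intro tendsto_intros) (simp add: o_def inverse_eq_divide)
  ultimately have "Sup S \<le> dual l"
    by (intro LIMSEQ_le[of "\<lambda>n. Sup S - 1 / real (Suc (r n))" "Sup S" "\<lambda>n. dual (u (r n))" "dual l"])
      (auto intro: less_imp_le[OF u(2)] simp del: of_nat_Suc)
  have "dual l' \<le> dual l" for l'
  proof (cases "dual (\<lambda>_. 0) \<le> dual l'")
    case True
    then have "dual l' \<le> Sup S" using bdd by (intro cSup_upper) (auto simp: S_def)
    with \<open>Sup S \<le> dual l\<close> show ?thesis by simp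
  next
    case False
    have "dual (\<lambda>_. 0) \<le> Sup S" using bdd by (intro cSup_upper) (auto simp: S_def)
    with False \<open>Sup S \<le> dual l\<close> show ?thesis by simp
  qed
  then show ?thesis by (rule that)
qed

section \<open>Optimality and uniqueness of the Gibbs density\<close>

text \<open>
  The vanishing gradient of the dual functional at a maximum, in variational form: moving the
  coordinate \<open>i\<close> by \<open>s\<close> with \<open>\<bar>s\<bar> \<le> 1\<close> changes it by at least \<open>s * (g i - m) - s\<^sup>2 * K\<close>, where
  \<open>m\<close> is the \<open>i\<close>-th moment. As this cannot be positive for small \<open>s\<close> of either sign, \<open>m = g i\<close>.
\<close>

lemma dual_max_imp_solution:
  assumes max: "\<And>l'. dual l' \<le> dual l"
  shows "solution (gibbs l)"
  unfolding solution_def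
proof (intro conjI ballI)
  show "integrable M (gibbs l)" by (rule integrable_gibbs)
  show "AE x in M. 0 \<le> gibbs l x" using gibbs_pos by (auto intro: less_imp_le)
  fix i assume i: "i \<in> I"
  show int: "integrable M (\<lambda>x. \<phi> i x * gibbs l x)" using i by (rule integrable_\<phi>_gibbs)
  define m where "m = (\<integral>x. \<phi> i x * gibbs l x \<partial>M)"
  define K where "K = (\<integral>x. ((\<phi> i x)\<^sup>2 * exp \<bar>\<phi> i x\<bar>) * gibbs l x \<partial>M)"
  have intK: "integrable M (\<lambda>x. ((\<phi> i x)\<^sup>2 * exp \<bar>\<phi> i x\<bar>) * gibbs l x)"
  proof (rule integrable_times_gibbs[where C = 2 and A = 2])
    fix x
    have "(\<phi> i x)\<^sup>2 * exp \<bar>\<phi> i x\<bar> \<le> (2 * exp \<bar>\<phi> i x\<bar>) * exp \<bar>\<phi> i x\<bar>"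
      using square_le_exp[of "\<bar>\<phi> i x\<bar>"] by (intro mult_right_mono) auto
    also have "\<dots> = 2 * exp (2 * \<bar>\<phi> i x\<bar>)" by (simp add: mult_exp_exp)
    also have "\<dots> \<le> 2 * exp (2 * envelope x)" using abs_\<phi>_le_envelope[OF i] by simp
    finally show "\<bar>(\<phi> i x)\<^sup>2 * exp \<bar>\<phi> i x\<bar>\<bar> \<le> 2 * exp (2 * envelope x)" by simp
  qed measurable
  have variation: "s * (g i - m) \<le> s\<^sup>2 * K" if s: "\<bar>s\<bar> \<le> 1" for s
  proof -
    define l' where "l' j = l j + (if j = i then s else 0)" for j
    have split: "(\<Sum>j\<in>I. l' j * y j) = (\<Sum>j\<in>I. l j * y j) + s * y i" for y
    proof -
      have "(\<Sum>j\<in>I. l' j * y j) = (\<Sum>j\<in>I. l j * y j + (if j = i then s * y i else 0))"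
        by (intro sum.cong) (auto simp: l'_def algebra_simps)
      then show ?thesis using finite_I i by (simp add: sum.distrib)
    qed
    have pair: "pairing l' = pairing l + s * g i"
      using split[of g] by (simp add: pairing_def mult.commute)
    have linl': "lin l' x = lin l x + s * \<phi> i x" for x
      unfolding lin_def by (rule split)
    have "(\<integral>x. gibbs l' x \<partial>M)
        \<le> (\<integral>x. gibbs l x + s * (\<phi> i x * gibbs l x) + s\<^sup>2 * (((\<phi> i x)\<^sup>2 * exp \<bar>\<phi> i x\<bar>) * gibbs l x) \<partial>M)"
    proof (rule integral_mono)
      show "integrable M (\<lambda>x. gibbs l x + s * (\<phi> i x * gibbs l x)
          + s\<^sup>2 * (((\<phi> i x)\<^sup>2 * exp \<bar>\<phi> i x\<bar>) * gibbs l x))"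
        using integrable_gibbs int intK by simp
      fix x
      let ?z = "s * \<phi> i x"
      have "\<bar>?z\<bar> \<le> \<bar>\<phi> i x\<bar>" using s by (simp add: abs_mult mult_left_le_one_le)
      then have "?z\<^sup>2 * exp \<bar>?z\<bar> \<le> ?z\<^sup>2 * exp \<bar>\<phi> i x\<bar>" by (intro mult_left_mono) auto
      with exp_quadratic_bound[of ?z]
      have "exp ?z \<le> 1 + ?z + s\<^sup>2 * ((\<phi> i x)\<^sup>2 * exp \<bar>\<phi> i x\<bar>)"
        unfolding power_mult_distrib by (simp only: mult.assoc)
      then have "exp ?z * gibbs l x \<le> (1 + ?z + s\<^sup>2 * ((\<phi> i x)\<^sup>2 * exp \<bar>\<phi> i x\<bar>)) * gibbs l x"
        using gibbs_pos[of l x] by (intro mult_right_mono) auto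
      then show "gibbs l' x \<le> gibbs l x + s * (\<phi> i x * gibbs l x)
          + s\<^sup>2 * (((\<phi> i x)\<^sup>2 * exp \<bar>\<phi> i x\<bar>) * gibbs l x)"
        by (simp add: gibbs_def linl' exp_add algebra_simps)
    qed (rule integrable_gibbs)
    also have "\<dots> = (\<integral>x. gibbs l x \<partial>M) + s * m + s\<^sup>2 * K"
      using integrable_gibbs int intK by (simp add: m_def K_def)
    finally show ?thesis
      using max[of l'] by (simp add: dual_def pair algebra_simps)
  qed
  show "(\<integral>x. \<phi> i x * gibbs l x \<partial>M) = g i"
  proof (rule ccontr)
    assume "(\<integral>x. \<phi> i x * gibbs l x \<partial>M) \<noteq> g i"
    then have d: "g i - m \<noteq> 0" by (simp add: m_def)
    \<comment> \<open>\<open>b\<close> exceeds \<open>K\<close>, so the linear term wins, and \<open>\<bar>g i - m\<bar>\<close>, so that \<open>\<bar>s\<bar> \<le> 1\<close>.\<close>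
    define b where "b = \<bar>K\<bar> + \<bar>g i - m\<bar> + 1"
    have b: "b > 0" by (simp add: b_def)
    define s where "s = (g i - m) / b"
    have "\<bar>s\<bar> \<le> 1" using b by (simp add: s_def b_def)
    from variation[OF this] have le: "(g i - m)\<^sup>2 / b * 1 \<le> (g i - m)\<^sup>2 / b * (K / b)"
      by (simp add: s_def power2_eq_square)
    have "(g i - m)\<^sup>2 / b > 0" using d b by simp
    with le have "1 \<le> K / b" by (simp only: mult_le_cancel_left_pos)
    then show False using b by (simp add: b_def)
  qed
qed

text \<open>
  The moment equations turn the difference of dual values into the integral of the Bregman
  divergence \<open>gibbs l * (exp z - 1 - z)\<close> with \<open>z = lin l' - lin l\<close>. This integrand vanishes only
  where the two linear combinations agree, and by independence of the features
  agreement almost everywhere means equality of the coefficients.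
\<close>

lemma solution_gibbs_imp_dual_max:
  assumes sol: "solution (gibbs l)"
  shows "dual l' \<le> dual l" and "dual l' = dual l \<Longrightarrow> i \<in> I \<Longrightarrow> l' i = l i"
proof -
  define d where "d x = gibbs l' x - gibbs l x - (lin l' x * gibbs l x - lin l x * gibbs l x)" for x
  have int: "integrable M d"
    unfolding d_def[abs_def]
    by (intro Bochner_Integration.integrable_diff integrable_gibbs solution_lin_integrable[OF sol])
  have gap: "dual l - dual l' = (\<integral>x. d x \<partial>M)"
    unfolding d_def dual_def using integrable_gibbs solution_lin_integrable[OF sol] solution_lin_integral[OF sol]
    by simp
  have d: "d x = gibbs l x * (exp (lin l' x - lin l x) - (1 + (lin l' x - lin l x)))" for x
  proof -
    have "gibbs l' x = gibbs l x * exp (lin l' x - lin l x)"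
      by (simp add: gibbs_def mult.commute mult.left_commute flip: exp_add)
    then show ?thesis unfolding d_def by (simp add: algebra_simps)
  qed
  have nonneg: "d x \<ge> 0" for x
    unfolding d using gibbs_pos[of l x] exp_ge_add_one_self[of "lin l' x - lin l x"]
    by (intro mult_nonneg_nonneg) auto
  have "0 \<le> (\<integral>x. d x \<partial>M)"
    using nonneg by (intro integral_nonneg_AE AE_I2)
  with gap show "dual l' \<le> dual l" by simp
  assume "dual l' = dual l" "i \<in> I"
  then have "AE x in M. d x = 0"
    using gap int nonneg by (subst integral_nonneg_eq_0_iff_AE[symmetric]) auto
  then have eq: "AE x in M. lin (\<lambda>i. l' i - l i) x = 0"
  proof eventually_elim
    fix x assume "d x = 0"
    then have "exp (lin l' x - lin l x) = 1 + (lin l' x - lin l x)"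
      using gibbs_pos[of l x] by (auto simp: d)
    then have "lin l' x - lin l x = 0" by (simp only: exp_eq_add_one_iff)
    then show "lin (\<lambda>i. l' i - l i) x = 0"
      by (simp add: lin_def left_diff_distrib sum_subtractf)
  qed
  show "l' i = l i"
  proof (rule ccontr)
    assume "l' i \<noteq> l i"
    then have "\<exists>i\<in>I. l' i - l i \<noteq> 0" using \<open>i \<in> I\<close> by auto
    from independent[OF this] eq have "AE x in M. False"
      by eventually_elim (simp add: lin_def)
    with solution_not_AE_False[OF sol] show False by blast
  qed
qed

lemma free_energy_gibbs:
  assumes sol: "solution (gibbs l)"
  shows "free_energy (gibbs l) = ereal (dual l)"
proof -
  have "(gibbs l x / w x * ln (gibbs l x / w x)) * w x = lin l x * gibbs l x" for x
    using w_pos[of x] by (simp add: gibbs_def)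
  then show ?thesis
    unfolding free_energy_def dual_def
    using solution_lin_integrable[OF sol] solution_lin_integral[OF sol] solution_mass[OF sol]
    by (simp add: extended_integral_integrable)
qed

text \<open>
  Weak duality, by integrating the Fenchel-Young inequality with \<open>x = f / w\<close> and
  \<open>p = lin l\<close>; the moments of \<open>f\<close> make the lower bound independent of \<open>f\<close>. Equality of the integrals
  forces equality in the pointwise inequality, hence \<open>f = gibbs l\<close>.
\<close>

lemma free_energy_ge_dual:
  assumes sol: "solution (gibbs l)" and f: "solution f"
  shows "ereal (dual l) \<le> free_energy f"
    and "free_energy f = ereal (dual l) \<Longrightarrow> AE x in M. f x = gibbs l x"
proof -
  have f_int: "integrable M f" and f0: "AE x in M. 0 \<le> f x" using f by (auto simp: solution_def)
  then have [measurable]: "f \<in> borel_measurable M" by auto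
  define u where "u x = (f x / w x * ln (f x / w x)) * w x" for x
  define h where "h x = lin l x * f x + f x - gibbs l x" for x
  have u: "u \<in> borel_measurable M" unfolding u_def[abs_def] by measurable
  have h: "integrable M h"
    unfolding h_def[abs_def] 
    by (intro Bochner_Integration.integrable_diff Bochner_Integration.integrable_add
        integrable_gibbs solution_lin_integrable[OF f] f_int)
  have "(\<integral>x. h x \<partial>M) = pairing l + 1 - (\<integral>x. gibbs l x \<partial>M)"
    unfolding h_def using solution_lin_integrable[OF f] f_int integrable_gibbs
      solution_lin_integral[OF f] solution_mass[OF f] by simp
  then have h_dual: "(\<integral>x. h x \<partial>M) = dual l" by (simp add: dual_def)
  have hw: "h x = (f x / w x * lin l x + f x / w x - exp (lin l x)) * w x" for x
    using w_pos[of x] by (simp add: h_def gibbs_def field_simps)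
  have le: "AE x in M. h x \<le> u x"
    using f0
  proof eventually_elim
    fix x assume "0 \<le> f x"
    then show "h x \<le> u x" unfolding u_def hw
      using w_pos[of x] by (intro mult_right_mono x_ln_x_Young) auto
  qed
  show "ereal (dual l) \<le> free_energy f"
    using extended_integral_ge(1)[OF u h le] by (simp add: h_dual free_energy_def u_def)
  assume "free_energy f = ereal (dual l)"
  then have "AE x in M. u x = h x"
    using extended_integral_ge(2)[OF u h le] by (simp add: h_dual free_energy_def u_def)
  then show "AE x in M. f x = gibbs l x"
    using f0
  proof eventually_elim
    fix x assume "u x = h x" "0 \<le> f x"
    then have "f x / w x = exp (lin l x)"
      using w_pos[of x] by (intro x_ln_x_Young(2)) (auto simp: u_def hw)
    then show "f x = gibbs l x" using w_pos[of x] by (simp add: gibbs_def field_simps)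
  qed
qed

lemma no_recession_imp_gibbs_solution:
  assumes no_recession
  obtains l where "solution (gibbs l)"
  using dual_attains_max[OF assms] dual_max_imp_solution by metis

end

section \<open>Zero sets of polynomials are null\<close>

text \<open>
  Every point lies in at most \<open>d\<close> of the translates of \<open>Z\<close>, hence in at most \<open>d\<close> of those of a
  bounded piece \<open>B\<close> of \<open>Z\<close>. The latter all lie in one ball \<open>C\<close>, so \<open>N\<close> of them have total
  measure \<open>N * \<mu> B \<le> d * \<mu> C\<close>. This holds for every \<open>N\<close>, and therefore \<open>\<mu> B = 0\<close>.
\<close>

lemma negligible_if_few_translates:
  fixes Z :: "'a::euclidean_space set" and a :: "nat \<Rightarrow> 'a"
  assumes Z: "closed Z"
    and a: "bounded (range a)"
    and few: "\<And>x. finite {m. x + a m \<in> Z}" "\<And>x. card {m. x + a m \<in> Z} \<le> d"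
  shows "negligible Z"
proof (subst negligible_on_intervals, intro allI)
  fix u v :: 'a
  define B where "B = Z \<inter> cbox u v"
  have B: "B \<in> lmeasurable"
    unfolding B_def using Z by (intro lmeasurable_compact) (auto simp: closed_Int_compact)
  obtain r where r: "norm (a m) \<le> r" for m
    using a by (auto simp: bounded_iff)
  obtain R where R: "\<And>x. x \<in> B \<Longrightarrow> norm x \<le> R"
    using bounded_subset[OF bounded_cbox[of u v], of B] by (auto simp: B_def bounded_iff)
  define C where "C = cball (0::'a) (R + r)"
  have C: "C \<in> lmeasurable" by (simp add: C_def)
  define Bs where "Bs m = (+) (- a m) ` B" for m
  have Bs: "Bs m \<in> lmeasurable" "measure lebesgue (Bs m) = measure lebesgue B" for m
    unfolding Bs_def using measurable_translation[OF B] measure_translation by blast+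
  have int: "integrable lebesgue (indicat_real (Bs m))" for m
    using Bs(1) by (simp add: lmeasurable_iff_integrable)
  have mem: "x \<in> Bs m \<longleftrightarrow> x + a m \<in> B" for x m
    unfolding Bs_def by (force simp: image_iff algebra_simps)
  have sub: "x \<in> C" if "x \<in> Bs m" for x m
  proof -
    have "norm x \<le> norm (x + a m) + norm (a m)"
      by (metis add_diff_cancel norm_triangle_ineq4)
    then show ?thesis
      using R[of "x + a m"] r[of m] that by (simp add: C_def mem)
  qed
  have le: "real N * measure lebesgue B \<le> real d * measure lebesgue C" for N
  proof -
    have "real N * measure lebesgue B = (\<Sum>m<N. measure lebesgue (Bs m))"
      by (simp add: Bs)
    also have "\<dots> = (\<integral>x. (\<Sum>m<N. indicator (Bs m) x) \<partial>lebesgue)"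
      using int by (subst Bochner_Integration.integral_sum) auto
    also have "\<dots> \<le> (\<integral>x. real d * indicator C x \<partial>lebesgue)"
    proof (rule integral_mono)
      show "integrable lebesgue (\<lambda>x. \<Sum>m<N. indicat_real (Bs m) x)"
        using int by (intro Bochner_Integration.integrable_sum)
      show "integrable lebesgue (\<lambda>x. real d * indicat_real C x)"
        using C by (auto simp: fmeasurable_def)
      fix x
      show "(\<Sum>m<N. indicat_real (Bs m) x) \<le> real d * indicat_real C x"
      proof (cases "x \<in> C")
        case False
        then have "\<And>m. x \<notin> Bs m" using sub by blast
        then show ?thesis by simp
      next
        case True
        have "(\<Sum>m<N. indicat_real (Bs m) x) = card {m\<in>{..<N}. x \<in> Bs m}"
          by (simp add: indicator_def of_bool_def sum.If_cases Int_def)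
        also have "card {m\<in>{..<N}. x \<in> Bs m} \<le> card {m. x + a m \<in> Z}"
          by (rule card_mono[OF few(1)]) (auto simp: mem B_def)
        finally show ?thesis using few(2)[of x] True by simp
      qed
    qed
    also have "\<dots> = real d * measure lebesgue C"
      using C by (simp add: fmeasurable_def)
    finally show ?thesis .
  qed
  have "measure lebesgue B = 0"
  proof (rule ccontr)
    assume "measure lebesgue B \<noteq> 0"
    then have "measure lebesgue B > 0" by (simp add: zero_less_measure_iff)
    then obtain N where "real N * measure lebesgue B > real d * measure lebesgue C"
      using reals_Archimedean3 by blast
    with le[of N] show False by simp
  qed
  then show "negligible (Z \<inter> cbox u v)"
    using B negligible_iff_measure unfolding B_def by blast
qed

lemma digit_sum_inject:
  fixes a b :: "nat \<Rightarrow> nat"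
  assumes "\<And>j. j < n \<Longrightarrow> a j < D" "\<And>j. j < n \<Longrightarrow> b j < D"
    and "(\<Sum>j<n. a j * D ^ j) = (\<Sum>j<n. b j * D ^ j)"
    and "j < n"
  shows "a j = b j"
  using assms
proof (induction n arbitrary: a b j)
  case 0
  then show ?case by simp
next
  case (Suc n)
  have split: "(\<Sum>j<Suc n. c j * D ^ j) = c 0 + D * (\<Sum>j<n. c (Suc j) * D ^ j)" for c :: "nat \<Rightarrow> nat"
    by (simp add: sum.lessThan_Suc_shift sum_distrib_left algebra_simps del: sum.lessThan_Suc)
  have D: "a 0 < D" "b 0 < D" using Suc.prems by auto
  have eq: "a 0 + D * (\<Sum>j<n. a (Suc j) * D ^ j) = b 0 + D * (\<Sum>j<n. b (Suc j) * D ^ j)"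
    using Suc.prems(3) unfolding split .
  have 0: "a 0 = b 0"
    using arg_cong[OF eq, of "\<lambda>x. x mod D"] D by simp
  then have "(\<Sum>j<n. a (Suc j) * D ^ j) = (\<Sum>j<n. b (Suc j) * D ^ j)"
    using eq D by simp
  then have "a (Suc j) = b (Suc j)" if "j < n" for j
    using Suc.IH[of "\<lambda>j. a (Suc j)" "\<lambda>j. b (Suc j)" j] Suc.prems(1,2) that by auto
  with 0 Suc.prems(4) show ?case by (cases j) auto
qed

lemma mpow_continuous [continuous_intros]: "continuous_on S (\<lambda>t. mpow t i)"
  unfolding mpow_def by (intro continuous_intros)

text \<open>
  Translate along the curve \<open>c s\<close> with coordinates \<open>s ^ (D ^ j)\<close>, in the manner of Kronecker
  substitution. If \<open>D\<close> exceeds all exponents, distinct monomials at \<open>x + c s\<close> become monic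
  polynomials in \<open>s\<close> of distinct degrees \<open>wt i\<close>, by uniqueness of base-\<open>D\<close> digits. Hence for
  every \<open>x\<close> the value at \<open>x + c s\<close> is a polynomial in \<open>s\<close> whose leading coefficient is that of
  the monomial of largest weight among those with \<open>v i \<noteq> 0\<close>, and its number of roots is bounded independently of \<open>x\<close>. So
  every point lies in boundedly many of the translates of the zero set by \<open>- c s\<close>.
\<close>

lemma negligible_polynomial_zeros:
  fixes v :: "nat ^ 'n \<Rightarrow> real"
  assumes I: "finite I" and v: "\<exists>i\<in>I. v i \<noteq> 0"
  shows "negligible {t. (\<Sum>i\<in>I. v i * mpow t i) = 0}" (is "negligible ?Z")
proof -
  obtain e where e: "bij_betw e (UNIV :: 'n set) {..<CARD('n)}"
    using ex_bij_betw_finite_nat[of "UNIV :: 'n set"] by (auto simp: atLeast0LessThan)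
  define D where "D = Suc (\<Sum>i\<in>I. mdeg i)"
  have ltD: "i $ j < D" if "i \<in> I" for i j
  proof -
    have "i $ j \<le> mdeg i" unfolding mdeg_def by (rule member_le_sum) auto
    also have "\<dots> \<le> (\<Sum>i\<in>I. mdeg i)" using I that by (intro member_le_sum) auto
    finally show ?thesis by (simp add: D_def)
  qed
  define wt where "wt i = (\<Sum>j\<in>UNIV. i $ j * D ^ e j)" for i :: "nat ^ 'n"
  have inj: "inj_on wt I"
  proof (rule inj_onI)
    fix a b assume ab: "a \<in> I" "b \<in> I" "wt a = wt b"
    define e' where "e' = inv_into UNIV e"
    have e'e: "e' (e j) = j" for j
      unfolding e'_def using e by (simp add: bij_betw_def)
    have reindex: "wt i = (\<Sum>m<CARD('n). i $ e' m * D ^ m)" for i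
      unfolding wt_def using sum.reindex_bij_betw[OF e, of "\<lambda>m. i $ e' m * D ^ m"] by (simp add: e'e)
    have "a $ e' m = b $ e' m" if "m < CARD('n)" for m
      by (rule digit_sum_inject[of "CARD('n)" "\<lambda>m. a $ e' m" D "\<lambda>m. b $ e' m"])
        (use ab ltD that in \<open>auto simp: reindex\<close>)
    moreover have "e j < CARD('n)" for j using e by (auto simp: bij_betw_def)
    ultimately show "a = b" by (metis e'e vec_eq_iff)
  qed
  define J where "J = {i\<in>I. v i \<noteq> 0}"
  have J: "finite J" "J \<noteq> {}" "J \<subseteq> I" using I v by (auto simp: J_def)
  define W where "W = Max (wt ` J)"
  have "W \<in> wt ` J" unfolding W_def using J by (intro Max_in) auto
  then obtain i1 where i1: "i1 \<in> J" "wt i1 = W" by auto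
  have le_W: "wt i \<le> W" if "i \<in> J" for i
    using J that unfolding W_def by auto
  define c where "c s = (\<chi> j. s ^ (D ^ e j))" for s :: real
  define fac where "fac x i = (\<Prod>j\<in>UNIV. ([:x $ j:] + monom 1 (D ^ e j)) ^ (i $ j))"
    for x :: "real ^ 'n" and i :: "nat ^ 'n"
  have lin: "degree ([:b:] + monom 1 d) = d" "lead_coeff ([:b:] + monom 1 d) = 1"
    if d: "d > 0" for b :: real and d
  proof -
    show deg: "degree ([:b:] + monom 1 d) = d"
      using d by (simp add: degree_add_eq_right degree_monom_eq)
    show "lead_coeff ([:b:] + monom 1 d) = 1"
      using d unfolding deg by (simp add: coeff_pCons split: nat.split)
  qed
  have Dpos: "D ^ m > 0" for m by (simp add: D_def)
  have nz: "[:b:] + monom 1 (D ^ m) \<noteq> 0" for b :: real and m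
    using lin(1)[OF Dpos[of m], of b] Dpos[of m] by fastforce
  have deg: "degree (fac x i) = wt i" for x i
    using lin(1)[OF Dpos] nz unfolding fac_def wt_def
    by (simp add: degree_prod_eq_sum_degree degree_power_eq)
  have "lead_coeff (fac x i) = 1" for x i
    unfolding fac_def lead_coeff_prod lead_coeff_power lin(2)[OF Dpos] by simp
  then have monic: "coeff (fac x i) (wt i) = 1" for x i
    by (simp add: deg)
  define q where "q x = (\<Sum>i\<in>J. smult (v i) (fac x i))" for x
  have qJ: "(\<Sum>i\<in>I. v i * y i) = (\<Sum>i\<in>J. v i * y i)" for y
    using I unfolding J_def by (intro sum.mono_neutral_right) auto
  have poly_q: "poly (q x) s = (\<Sum>i\<in>I. v i * mpow (x + c s) i)" for x s
    unfolding qJ q_def fac_def mpow_def c_def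
    by (simp add: poly_sum poly_prod poly_monom)
  have coeff_q: "coeff (q x) W = v i1" for x
  proof -
    have "coeff (q x) W = (\<Sum>i\<in>J. if i = i1 then v i1 else 0)"
      unfolding q_def coeff_sum
    proof (rule sum.cong[OF refl])
      fix i assume i: "i \<in> J"
      show "coeff (smult (v i) (fac x i)) W = (if i = i1 then v i1 else 0)"
      proof (cases "i = i1")
        case True
        then show ?thesis using monic[of x i] i1 by simp
      next
        case False
        then have "wt i \<noteq> W" using inj i i1 J by (metis inj_on_contraD subsetD)
        then have "degree (fac x i) < W" using le_W[OF i] by (simp add: deg)
        then show ?thesis using False by (simp add: coeff_eq_0)
      qed
    qed
    then show ?thesis using J i1 by simp
  qed
  then have q0: "q x \<noteq> 0" for x using coeff_q[of x] i1(1) by (metis (mono_tags, lifting) J_def coeff_0 mem_Collect_eq)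
  have qW: "degree (q x) \<le> W" for x
    unfolding q_def using le_W J
    by (intro degree_sum_le) (auto intro!: order.trans[OF degree_smult_le] simp: deg)
  define s where "s m = 1 / real (Suc m)" for m
  have inj_s: "inj s" by (auto simp: inj_def s_def)
  have roots: "{m. x + c (s m) \<in> ?Z} = s -` {r. poly (q x) r = 0}" for x
    by (auto simp: poly_q)
  show ?thesis
  proof (rule negligible_if_few_translates)
    show "closed ?Z" by (intro closed_Collect_eq continuous_intros)
    have "norm (c (s m)) \<le> real CARD('n)" for m
    proof -
      have "norm (c (s m)) \<le> (\<Sum>j\<in>UNIV. \<bar>c (s m) $ j\<bar>)" by (rule norm_le_l1_cart)
      also have "\<dots> \<le> (\<Sum>j\<in>(UNIV::'n set). 1)"
        by (intro sum_mono) (auto simp: c_def s_def power_le_one)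
      finally show ?thesis by simp
    qed
    then show "bounded (range (\<lambda>m. c (s m)))" by (auto simp: bounded_iff)
    fix x
    have fin: "finite {r. poly (q x) r = 0}" by (rule poly_roots_finite[OF q0])
    show "finite {m. x + c (s m) \<in> ?Z}"
      unfolding roots using fin inj_s by (intro finite_vimageI) auto
    have "card (s -` {r. poly (q x) r = 0}) \<le> card {r. poly (q x) r = 0}"
      using card_vimage_inj_on_le[OF inj_s fin] by simp
    also have "\<dots> \<le> W" using card_poly_roots_bound[OF q0] qW order.trans by blast
    finally show "card {m. x + c (s m) \<in> ?Z} \<le> W" unfolding roots .
  qed
qed

section \<open>Integrability of exponentials of polynomials\<close>

lemma integrable_exp_abs:
  fixes a :: real
  assumes "a > 0"
  shows "integrable lborel (\<lambda>x::real. exp (- a * \<bar>x\<bar>))"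
proof -
  have 1: "set_integrable lborel {0..} (\<lambda>x. exp (- a * x))"
  proof -
    have "(\<lambda>x. exp (-a * x)) absolutely_integrable_on {0..}"
      using assms by (intro nonnegative_absolutely_integrable_1 integrable_on_exp_minus_to_infinity) auto
    then show ?thesis
      unfolding set_integrable_def by (subst (asm) integrable_completion) auto
  qed
  have 2: "integrable lborel (\<lambda>x. indicator {0..} (-x) *\<^sub>R exp (- a * (-x)))"
    using lborel_integrable_real_affine[OF 1[unfolded set_integrable_def], of "-1" 0] by simp
  show ?thesis
    by (rule Bochner_Integration.integrable_bound[OF Bochner_Integration.integrable_add[OF 1[unfolded set_integrable_def] 2]])
      (auto simp: indicator_def)
qed

text \<open>
  The norm dominates the average of the absolute coordinates, so the integrand is bounded by a
  product of one-dimensional exponentials.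
\<close>

lemma integrable_exp_minus_norm:
  "integrable lborel (\<lambda>t::'a::euclidean_space. exp (- norm t))"
proof (rule integrableI_bounded)
  define a where "a = 1 / real DIM('a)"
  have a: "a > 0" by (simp add: a_def)
  have "(\<integral>\<^sup>+ t. ennreal (norm (exp (- norm t))) \<partial>(lborel :: 'a measure))
      \<le> (\<integral>\<^sup>+ t. (\<Prod>b\<in>Basis. ennreal (exp (- a * \<bar>t \<bullet> b\<bar>))) \<partial>(lborel :: 'a measure))"
  proof (rule nn_integral_mono)
    fix t :: 'a
    have "(\<Sum>b\<in>Basis. a * \<bar>t \<bullet> b\<bar>) \<le> (\<Sum>b\<in>(Basis::'a set). a * norm t)"
      using a by (intro sum_mono mult_left_mono Basis_le_norm) auto
    also have "\<dots> = norm t" by (simp add: a_def)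
    finally have "exp (- norm t) \<le> exp (\<Sum>b\<in>Basis. - a * \<bar>t \<bullet> b\<bar>)"
      by (simp add: sum_negf)
    then show "ennreal (norm (exp (- norm t))) \<le> (\<Prod>b\<in>Basis. ennreal (exp (- a * \<bar>t \<bullet> b\<bar>)))"
      by (simp add: exp_sum prod_ennreal ennreal_leI)
  qed
  also have "\<dots> = (\<Prod>b\<in>(Basis::'a set). (\<integral>\<^sup>+ x. ennreal (exp (- a * \<bar>x\<bar>)) \<partial>lborel))"
    by (subst nn_integral_lborel_prod) auto
  also have "\<dots> < \<infinity>"
  proof -
    have "(\<integral>\<^sup>+ x. ennreal (exp (- a * \<bar>x\<bar>)) \<partial>lborel) < \<infinity>"
      using integrable_exp_abs[OF a] by (simp add: integrable_iff_bounded)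
    then show ?thesis by (simp add: power_less_top_ennreal)
  qed
  finally show "(\<integral>\<^sup>+ t. ennreal (norm (exp (- norm t))) \<partial>(lborel :: 'a measure)) < \<infinity>" .
qed auto

lemma abs_mpow_le: "\<bar>mpow t i\<bar> \<le> norm t ^ mdeg i"
proof -
  have "\<bar>mpow t i\<bar> = (\<Prod>j\<in>UNIV. \<bar>t $ j\<bar> ^ (i $ j))"
    by (simp add: mpow_def abs_prod power_abs)
  also have "\<dots> \<le> (\<Prod>j\<in>UNIV. norm t ^ (i $ j))"
    by (intro prod_mono) (auto intro!: power_mono component_le_norm_cart)
  also have "\<dots> = norm t ^ mdeg i" by (simp add: mdeg_def power_sum)
  finally show ?thesis .
qed

text \<open>
  Once \<open>r > A / \<epsilon>\<close> the term \<open>\<epsilon> * r ^ Suc d\<close> exceeds \<open>A * r ^ d\<close>.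
\<close>

lemma polynomial_growth_bound:
  fixes \<epsilon> A :: real
  assumes "\<epsilon> > 0" "A \<ge> 0"
  obtains C where "\<And>r. r \<ge> 0 \<Longrightarrow> A * (1 + r ^ d) - \<epsilon> * r ^ Suc d \<le> C"
proof
  fix r :: real assume r: "r \<ge> 0"
  show "A * (1 + r ^ d) - \<epsilon> * r ^ Suc d \<le> A * (1 + (A / \<epsilon>) ^ d)"
  proof (cases "r \<le> A / \<epsilon>")
    case True
    then have "r ^ d \<le> (A / \<epsilon>) ^ d" using r by (intro power_mono)
    then have "A * (1 + r ^ d) \<le> A * (1 + (A / \<epsilon>) ^ d)" using assms by (intro mult_left_mono) auto
    then show ?thesis using assms r by (smt (verit) mult_nonneg_nonneg zero_le_power)
  next
    case False
    then have "A - \<epsilon> * r \<le> 0" using assms by (simp add: field_simps)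
    then have "(A - \<epsilon> * r) * r ^ d \<le> 0" using r by (simp add: mult_nonpos_nonneg)
    then have "A * (1 + r ^ d) - \<epsilon> * r ^ Suc d \<le> A" by (simp add: algebra_simps)
    also have "A \<le> A * (1 + (A / \<epsilon>) ^ d)" using assms by (simp add: algebra_simps)
    finally show ?thesis .
  qed
qed

lemma integrable_exp_monomials_weight:
  fixes I :: "(nat ^ 'n) set"
  assumes I: "finite I" and deg: "\<And>i. i \<in> I \<Longrightarrow> mdeg i < 2 * k + 2" and \<epsilon>: "\<epsilon> > 0"
    and T: "T \<in> sets lebesgue"
  shows "integrable (lebesgue_on T) (\<lambda>t. exp (A * (\<Sum>i\<in>I. \<bar>mpow t i\<bar>)) * weight \<epsilon> k t)"
proof -
  \<comment> \<open>The additional \<open>1\<close> pays for the term \<open>norm t\<close> left in the exponent.\<close>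
  define B where "B = \<bar>A\<bar> * card I + 1"
  have B: "B \<ge> 1" by (simp add: B_def)
  obtain C where C: "\<And>r. r \<ge> 0 \<Longrightarrow> B * (1 + r ^ (2*k+1)) - \<epsilon> * r ^ Suc (2*k+1) \<le> C"
    using polynomial_growth_bound[OF \<epsilon>, of B] B by (metis order.trans zero_le_one)
  have power_le: "r ^ d \<le> 1 + r ^ (2*k+1)" if "r \<ge> 0" "d < 2*k+2" for r :: real and d
  proof (cases "r \<le> 1")
    case True
    then have "r ^ d \<le> 1" using that by (simp add: power_le_one)
    then show ?thesis using that by (smt (verit) zero_le_power)
  next
    case False
    then have "r ^ d \<le> r ^ (2*k+1)" using that by (intro power_increasing) auto
    then show ?thesis by simp
  qed
  have bound: "exp (A * (\<Sum>i\<in>I. \<bar>mpow t i\<bar>)) * weight \<epsilon> k t \<le> exp C * exp (- norm t)" for t :: "real ^ 'n"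
  proof -
    let ?r = "norm t"
    have "(\<Sum>i\<in>I. \<bar>mpow t i\<bar>) \<le> (\<Sum>i\<in>I. 1 + ?r ^ (2*k+1))"
      using deg by (intro sum_mono) (meson abs_mpow_le norm_ge_zero order.trans power_le)
    then have "\<bar>A\<bar> * (\<Sum>i\<in>I. \<bar>mpow t i\<bar>) \<le> \<bar>A\<bar> * card I * (1 + ?r ^ (2*k+1))"
      by (simp add: mult_left_mono mult.assoc)
    moreover have "A * (\<Sum>i\<in>I. \<bar>mpow t i\<bar>) \<le> \<bar>A\<bar> * (\<Sum>i\<in>I. \<bar>mpow t i\<bar>)"
      by (intro mult_right_mono) (auto intro: sum_nonneg)
    moreover have "?r \<le> 1 + ?r ^ (2*k+1)" using power_le[of ?r 1] by simp
    ultimately have "A * (\<Sum>i\<in>I. \<bar>mpow t i\<bar>) + ?r \<le> B * (1 + ?r ^ (2*k+1))"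
      unfolding B_def by (simp add: algebra_simps)
    with C[of ?r] have "A * (\<Sum>i\<in>I. \<bar>mpow t i\<bar>) - \<epsilon> * ?r ^ (2*k+2) \<le> C - ?r"
      by simp
    then show ?thesis by (simp add: weight_def flip: exp_add)
  qed
  have int_leb: "integrable lebesgue (\<lambda>t::real^'n. exp C * exp (- norm t))"
    using integrable_exp_minus_norm by (simp add: integrable_completion)
  have int: "integrable (lebesgue_on T) (\<lambda>t::real^'n. exp C * exp (- norm t))"
    using integrable_mult_indicator[OF T int_leb] T by (subst integrable_restrict_space) auto
  show ?thesis
  proof (rule Bochner_Integration.integrable_bound[OF int])
    have "(\<lambda>t. exp (A * (\<Sum>i\<in>I. \<bar>mpow t i\<bar>)) * weight \<epsilon> k t) \<in> borel_measurable borel"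
      unfolding weight_def by (intro borel_measurable_continuous_onI continuous_intros)
    then show "(\<lambda>t. exp (A * (\<Sum>i\<in>I. \<bar>mpow t i\<bar>)) * weight \<epsilon> k t) \<in> borel_measurable (lebesgue_on T)"
      by (intro measurable_restrict_space1 measurable_completion) simp
    show "AE t in lebesgue_on T. norm (exp (A * (\<Sum>i\<in>I. \<bar>mpow t i\<bar>)) * weight \<epsilon> k t)
        \<le> norm (exp C * exp (- norm t))"
      using bound by (simp add: weight_def abs_mult)
  qed
qed

section \<open>The truncated moment problem on a closed set\<close>

lemma moment_family_monomials:
  fixes T :: "(real ^ 'n) set" and I :: "(nat ^ 'n) set"
  assumes T: "closed T" and I: "finite I" "0 \<in> I" and deg: "\<And>i. i \<in> I \<Longrightarrow> mdeg i < 2 * k + 2"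
    and "g 0 = 1" and \<epsilon>: "\<epsilon> > 0"
  shows "moment_family (lebesgue_on T) I (\<lambda>i t. mpow t i) (weight \<epsilon> k) g 0"
proof
  have T': "T \<in> sets lebesgue" using T by (simp add: lborelD)
  have borel: "f \<in> borel_measurable (lebesgue_on T)" if "continuous_on UNIV f" for f :: "real ^ 'n \<Rightarrow> real"
    using that by (intro measurable_restrict_space1 measurable_completion)
      (simp add: borel_measurable_continuous_onI)
  show "(\<lambda>t. mpow t i) \<in> borel_measurable (lebesgue_on T)" for i
    by (intro borel continuous_intros)
  show "weight \<epsilon> k \<in> borel_measurable (lebesgue_on T)"
    unfolding weight_def[abs_def] by (intro borel continuous_intros)
  show "mpow t 0 = 1" for t :: "real ^ 'n" by (simp add: mpow_def)
  show "weight \<epsilon> k t > 0" for t :: "real ^ 'n" by (simp add: weight_def)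
  show "integrable (lebesgue_on T) (\<lambda>t. exp (A * (\<Sum>i\<in>I. \<bar>mpow t i\<bar>)) * weight \<epsilon> k t)" for A
    using I(1) deg \<epsilon> T' by (rule integrable_exp_monomials_weight)
  fix v :: "nat ^ 'n \<Rightarrow> real" assume "\<exists>i\<in>I. v i \<noteq> 0"
  then have "AE t in lebesgue. t \<notin> {t. (\<Sum>i\<in>I. v i * mpow t i) = 0}"
    by (intro AE_not_in) (use negligible_polynomial_zeros[OF I(1)] in \<open>simp add: negligible_iff_null_sets\<close>)
  then show "AE t in lebesgue_on T. (\<Sum>i\<in>I. v i * mpow t i) \<noteq> 0"
    using T' by (subst AE_restrict_space_iff) (auto elim: eventually_mono)
qed (use assms in auto)

theorem corollary6:
  fixes T :: "(real ^ 'n) set"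
    and I :: "(nat ^ 'n) set"
    and g :: "nat ^ 'n \<Rightarrow> real"
    and k :: nat
    and \<epsilon> :: real
  assumes "closed T"
    and "finite I" and "0 \<in> I"
    and "Max (mdeg ` I) < 2 * k + 2"
    and "g 0 = 1"
    and "\<epsilon> > 0"
  shows "((\<exists>f. moment_solution T I g f) \<longleftrightarrow> (\<exists>f. entropy_maximizer T I g \<epsilon> k f))
    \<and> ((\<exists>f. entropy_maximizer T I g \<epsilon> k f) \<longleftrightarrow> sup_dual T I g \<epsilon> k < \<infinity>)
    \<and> ((\<exists>f. moment_solution T I g f) \<longrightarrow>
        (\<exists>fs ls.
            entropy_maximizer T I g \<epsilon> k fs
          \<and> (\<forall>f. entropy_maximizer T I g \<epsilon> k f \<longrightarrow> (AE t in lebesgue_on T. f t = fs t))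
          \<and> ls \<in> I \<rightarrow>\<^sub>E UNIV
          \<and> ereal (dual_functional T I g \<epsilon> k ls) = sup_dual T I g \<epsilon> k
          \<and> (\<forall>l \<in> I \<rightarrow>\<^sub>E UNIV.
                ereal (dual_functional T I g \<epsilon> k l) = sup_dual T I g \<epsilon> k \<longrightarrow> l = ls)
          \<and> - entropy_functional T \<epsilon> k fs = ereal (dual_functional T I g \<epsilon> k ls)
          \<and> (AE t in lebesgue_on T.
                fs t = exp ((\<Sum>i\<in>I. ls i * mpow t i) - \<epsilon> * norm t ^ (2 * k + 2)))
          \<and> (\<forall>i\<in>I. (\<integral>t. mpow t i * exp (\<Sum>j\<in>I. ls j * mpow t j)
                        * exp (- \<epsilon> * norm t ^ (2 * k + 2)) \<partial>lebesgue_on T) = g i)))"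
proof -
  have deg: "mdeg i < 2 * k + 2" if "i \<in> I" for i
    using assms(2,4) that by (meson Max_ge finite_imageI image_eqI le_less_trans)
  interpret F: moment_family "lebesgue_on T" I "\<lambda>i t. mpow t i" "weight \<epsilon> k" g 0
    by (rule moment_family_monomials) (use assms deg in auto)
  have gibbs: "exp ((\<Sum>i\<in>I. l i * mpow t i) - \<epsilon> * norm t ^ (2 * k + 2)) = F.gibbs l t" for l t
    by (simp add: F.gibbs_def F.lin_def weight_def flip: exp_add)
  have dual: "dual_functional T I g \<epsilon> k l = F.dual l" for l
    by (simp only: dual_functional_def gibbs F.dual_def F.pairing_def)
  have entropy: "entropy_functional T \<epsilon> k f = - F.free_energy f" for f
    by (simp add: entropy_functional_def F.free_energy_def)
  have solution: "moment_solution T I g f \<longleftrightarrow> F.solution f" for f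
  proof -
    have "(\<integral>\<^sup>+t. ennreal (\<bar>mpow t i\<bar> * f t) \<partial>lebesgue_on T) < \<infinity>
        \<longleftrightarrow> integrable (lebesgue_on T) (\<lambda>t. mpow t i * f t)"
      if f: "integrable (lebesgue_on T) f" "AE t in lebesgue_on T. 0 \<le> f t" for i
    proof -
      have "(\<integral>\<^sup>+t. ennreal (\<bar>mpow t i\<bar> * f t) \<partial>lebesgue_on T)
          = (\<integral>\<^sup>+t. ennreal (norm (mpow t i * f t)) \<partial>lebesgue_on T)"
        using f(2) by (intro nn_integral_cong_AE) (auto simp: abs_mult elim!: eventually_mono)
      moreover have "(\<lambda>t. mpow t i * f t) \<in> borel_measurable (lebesgue_on T)"
        using f(1) F.\<phi>_meas by (intro borel_measurable_times) auto
      ultimately show ?thesis by (simp add: integrable_iff_bounded)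
    qed
    then show ?thesis
      unfolding moment_solution_def F.solution_def L1_plus_def by blast
  qed
  have restrict: "F.dual (restrict l I) = F.dual l" "F.gibbs (restrict l I) = F.gibbs l" for l
    by (simp_all add: F.dual_def F.gibbs_def[abs_def] F.lin_def F.pairing_def)

  have main: "entropy_maximizer T I g \<epsilon> k (F.gibbs l)
      \<and> (\<forall>f. entropy_maximizer T I g \<epsilon> k f \<longrightarrow> (AE t in lebesgue_on T. f t = F.gibbs l t))
      \<and> sup_dual T I g \<epsilon> k = ereal (F.dual l)"
    if l: "F.solution (F.gibbs l)" for l
  proof (intro conjI allI impI)
    show max: "entropy_maximizer T I g \<epsilon> k (F.gibbs l)"
      unfolding entropy_maximizer_def solution entropy
      using l F.free_energy_ge_dual(1)[OF l]
      unfolding F.free_energy_gibbs[OF l] ereal_minus_le_minus by blast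
    show "AE t in lebesgue_on T. f t = F.gibbs l t" if "entropy_maximizer T I g \<epsilon> k f" for f
    proof (rule F.free_energy_ge_dual(2)[OF l])
      show f: "F.solution f" using that by (simp add: entropy_maximizer_def solution)
      have "F.free_energy f \<le> F.free_energy (F.gibbs l)"
        using that l by (simp add: entropy_maximizer_def solution entropy)
      then show "F.free_energy f = ereal (F.dual l)"
        using F.free_energy_ge_dual(1)[OF l f] F.free_energy_gibbs[OF l] by simp
    qed
    show "sup_dual T I g \<epsilon> k = ereal (F.dual l)"
      unfolding sup_dual_def dual
    proof (rule antisym)
      show "(SUP l\<in>I \<rightarrow>\<^sub>E UNIV. ereal (F.dual l)) \<le> ereal (F.dual l)"
        using F.solution_gibbs_imp_dual_max(1)[OF l] by (intro SUP_least) simp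
      show "ereal (F.dual l) \<le> (SUP l\<in>I \<rightarrow>\<^sub>E UNIV. ereal (F.dual l))"
        by (rule SUP_upper2[of "restrict l I"]) (auto simp: restrict)
    qed
  qed

  have a: "\<exists>l. F.solution (F.gibbs l)" if "moment_solution T I g f" for f
    using that F.solution_imp_no_recession F.no_recession_imp_gibbs_solution unfolding solution by metis
  have c: "\<exists>l. F.solution (F.gibbs l)" if fin: "sup_dual T I g \<epsilon> k < \<infinity>"
  proof -
    obtain B where B: "sup_dual T I g \<epsilon> k \<le> ereal B"
      using fin by (cases "sup_dual T I g \<epsilon> k") auto
    have "F.dual l \<le> B" for l
    proof -
      have "ereal (F.dual (restrict l I)) \<le> sup_dual T I g \<epsilon> k"
        unfolding sup_dual_def dual
        by (rule SUP_upper) (simp only: restrict_PiE_iff UNIV_I simp_thms ball_triv)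
      then have "ereal (F.dual l) \<le> ereal B" using B unfolding restrict by (rule order.trans)
      then show ?thesis by simp
    qed
    then have "F.no_recession" by (rule F.dual_bounded_imp_no_recession)
    then show ?thesis using F.no_recession_imp_gibbs_solution by metis
  qed

  show ?thesis
  proof (intro conjI impI)
    show "(\<exists>f. moment_solution T I g f) \<longleftrightarrow> (\<exists>f. entropy_maximizer T I g \<epsilon> k f)"
      using a main by (metis entropy_maximizer_def)
    show "(\<exists>f. entropy_maximizer T I g \<epsilon> k f) \<longleftrightarrow> sup_dual T I g \<epsilon> k < \<infinity>"
    proof
      assume "\<exists>f. entropy_maximizer T I g \<epsilon> k f"
      then obtain l where "F.solution (F.gibbs l)"
        using a unfolding entropy_maximizer_def by blast
      from main[OF this] show "sup_dual T I g \<epsilon> k < \<infinity>" by simp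
    next
      assume "sup_dual T I g \<epsilon> k < \<infinity>"
      from c[OF this] main show "\<exists>f. entropy_maximizer T I g \<epsilon> k f" by blast
    qed
    assume "\<exists>f. moment_solution T I g f"
    then obtain l where l: "F.solution (F.gibbs l)" using a by blast
    define ls where "ls = restrict l I"
    have ls: "F.solution (F.gibbs ls)" using l by (simp add: ls_def restrict)
    have ext: "ls \<in> I \<rightarrow>\<^sub>E UNIV" unfolding ls_def by (intro restrict_PiE_iff[THEN iffD2]) simp
    have "\<forall>l \<in> I \<rightarrow>\<^sub>E UNIV. ereal (F.dual l) = sup_dual T I g \<epsilon> k \<longrightarrow> l = ls"
    proof (intro ballI impI)
      fix l' assume l': "l' \<in> I \<rightarrow>\<^sub>E UNIV" "ereal (F.dual l') = sup_dual T I g \<epsilon> k"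
      then have "F.dual l' = F.dual ls" using main[OF ls] by simp
      then show "l' = ls"
        using F.solution_gibbs_imp_dual_max(2)[OF ls] l'(1) ext by (intro PiE_ext) auto
    qed
    moreover have "\<forall>i\<in>I. (\<integral>t. mpow t i * exp (\<Sum>j\<in>I. ls j * mpow t j)
                        * exp (- \<epsilon> * norm t ^ (2 * k + 2)) \<partial>lebesgue_on T) = g i"
    proof
      fix i assume i: "i \<in> I"
      have eq: "mpow t i * exp (\<Sum>j\<in>I. ls j * mpow t j) * exp (- \<epsilon> * norm t ^ (2 * k + 2))
          = mpow t i * F.gibbs ls t" for t
        by (simp add: F.gibbs_def F.lin_def weight_def mult.assoc)
      show "(\<integral>t. mpow t i * exp (\<Sum>j\<in>I. ls j * mpow t j)
                        * exp (- \<epsilon> * norm t ^ (2 * k + 2)) \<partial>lebesgue_on T) = g i"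
        unfolding eq using ls i unfolding F.solution_def by blast
    qed
    moreover have "- entropy_functional T \<epsilon> k (F.gibbs ls) = ereal (F.dual ls)"
      using F.free_energy_gibbs[OF ls] by (simp add: entropy)
    ultimately show "\<exists>fs ls.
            entropy_maximizer T I g \<epsilon> k fs
          \<and> (\<forall>f. entropy_maximizer T I g \<epsilon> k f \<longrightarrow> (AE t in lebesgue_on T. f t = fs t))
          \<and> ls \<in> I \<rightarrow>\<^sub>E UNIV
          \<and> ereal (dual_functional T I g \<epsilon> k ls) = sup_dual T I g \<epsilon> k
          \<and> (\<forall>l \<in> I \<rightarrow>\<^sub>E UNIV.
                ereal (dual_functional T I g \<epsilon> k l) = sup_dual T I g \<epsilon> k \<longrightarrow> l = ls)
          \<and> - entropy_functional T \<epsilon> k fs = ereal (dual_functional T I g \<epsilon> k ls)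
          \<and> (AE t in lebesgue_on T.
                fs t = exp ((\<Sum>i\<in>I. ls i * mpow t i) - \<epsilon> * norm t ^ (2 * k + 2)))
          \<and> (\<forall>i\<in>I. (\<integral>t. mpow t i * exp (\<Sum>j\<in>I. ls j * mpow t j)
                        * exp (- \<epsilon> * norm t ^ (2 * k + 2)) \<partial>lebesgue_on T) = g i)"
      unfolding dual gibbs using main[OF ls] ext
      by (intro exI[of _ "F.gibbs ls"] exI[of _ ls]) auto
  qed
qed

end
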